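(* Let $T_p$ be a connected directed rooted tree on $p$ nodes with edge set $E$ (so $|E|=p-1$), in which all edges are directed away from the root, and let $\lambda\in(0,1)$. Then: (i) $\dfrac{\operatorname{vol}(\mathcal M_{T_p,\lambda})}{2^{|E|}}\ge 1-(1-\lambda)^{p-1}$, (ii) $\dfrac{\operatorname{vol}(\mathcal N^{(1)}_{T_p,\lambda})}{2^{|E|}}\ge 1-(1-\lambda)^{p-1}$, (iii) $\dfrac{\operatorname{vol}(\mathcal N^{(2)}_{T_p,\lambda})}{2^{|E|}}\ge 1-(1-\lambda)^{p-1}$.
   Context: Model. For a directed acyclic graph (DAG) $G=(V,E)$ with $V=\{1,\dots,p\}$, topologically ordered, i.e. $i<j$ for all $(i,j)\in E$ (an edge $(i,j)$ means $i\to j$), and a parameter vector $a=(a_{ij})_{(i,j)\in E}\in[-1,1]^{|E|}$, let $A\in\mathbb{R}^{p\times p}$ be the strictly upper triangular matrix with $A_{ij}=a_{ij}$ for $(i,j)\in E$ and $A_{ij}=0$ otherwise. The random vector $X=(X_1,\dots,X_p)$ is defined by $X_j=\sum_{i<j}A_{ij}X_i+\varepsilon_j$ with $\varepsilon\sim\mathcal N(0,I)$, so $X\sim\mathcal N(0,[(I-A)(I-A)^T]^{-1})$. Conditional covariances and variances $\operatorname{cov}(X_i,X_j\mid X_S)$, $\operatorname{var}(X_i\mid X_S)$ are those of this Gaussian vector, and are functions of $a$. d-separation. Nodes $i\ne j$ are $d$-separated given $S\subset V\setminus\{i,j\}$ if every path between $i$ and $j$ in the skeleton of $G$ contains a noncollider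 (with respect to the path) that is in $S$, or a collider (node at which both path edges point into it) that is neither in $S$ nor an ancestor of a node in $S$. The skeleton is the underlying undirected graph; $i,j$ are adjacent if joined by an edge in the skeleton; $(i,j,k)$ is an unshielded triple if $i$ and $j$ are both adjacent to $k$ but $i$ and $j$ are not adjacent. $\deg(G)$ is the maximal degree (indegree plus outdegree) of nodes in $G$. Sets. For $i\neq j$ and $S\subset V\setminus\{i,j\}$, $$\mathcal P^{\lambda}_{ij\mid S}=\big\{a\in[-1,1]^{|E|}:\ |\operatorname{cov}(X_i,X_j\mid X_S)|\le\lambda\sqrt{\operatorname{var}(X_i\mid X_S)\operatorname{var}(X_j\mid X_S)}\big\}.$$ $\mathcal M_{G,\lambda}$ is the union of $\mathcal P^\lambda_{ij\mid S}$ over all $i\ne j$, $S\subset V\setminus\{i,j\}$ such that $i$ and $j$ are not $d$-separated given $S$. $\mathcal N^{(1)}_{G,\lambda}$ is the union of $\mathcal P^\lambda_{ij\mid S}$ over all triples $(i,j,S)$ with $S\subset V\setminus\{i,j\}$, $|S|\le\deg(G)$, such that either $(i,j)\in E$, or $i,j$ are not adjacent, are not $d$-separated given $S$, and there is $k\in V$ making $(i,j,k)$ an unshielded triple. $\mathcal N^{(2)}_{G,\lambda}$ is the union of $\mathcal P^\lambda_{ij\mid S}$ over all $(i,j,S)$ with $(i,j)\in E$, $S\subset V\setminus\{i,j\}$, $|S|\le\deg(G)$. $\operatorname{vol}$ is Lebesgue measure on $\mathbb{R}^{|E|}$. *)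

theory Defs
  imports "HOL-Probability.Probability"
begin

section \<open>Directed acyclic graphs on topologically ordered nodes\<close>

text \<open>A graph is given by its set of edges; the nodes are \<open>{1..p}\<close>.\<close>

definition nodes :: "nat \<Rightarrow> nat set" where
  "nodes p = {1..p}"

definition dag :: "nat \<Rightarrow> (nat \<times> nat) set \<Rightarrow> bool" where
  "dag p E \<longleftrightarrow> E \<subseteq> nodes p \<times> nodes p \<and> (\<forall>(i, j) \<in> E. i < j)"

definition adjacent :: "(nat \<times> nat) set \<Rightarrow> nat \<Rightarrow> nat \<Rightarrow> bool" where
  "adjacent E u v \<longleftrightarrow> (u, v) \<in> E \<or> (v, u) \<in> E"

definition skel_path :: "(nat \<times> nat) set \<Rightarrow> nat \<Rightarrow> nat list \<Rightarrow> nat \<Rightarrow> bool" where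
  "skel_path E u xs v \<longleftrightarrow>
     xs \<noteq> [] \<and> hd xs = u \<and> last xs = v \<and> distinct xs \<and> successively (adjacent E) xs"

definition skel_cycle :: "(nat \<times> nat) set \<Rightarrow> nat list \<Rightarrow> bool" where
  "skel_cycle E xs \<longleftrightarrow>
     length xs \<ge> 3 \<and> distinct xs \<and> successively (adjacent E) xs \<and> adjacent E (last xs) (hd xs)"

definition unshielded_triple :: "(nat \<times> nat) set \<Rightarrow> nat \<Rightarrow> nat \<Rightarrow> nat \<Rightarrow> bool" where
  "unshielded_triple E i j k \<longleftrightarrow>
     i \<noteq> j \<and> adjacent E i k \<and> adjacent E j k \<and> \<not> adjacent E i j"

definition max_degree :: "nat \<Rightarrow> (nat \<times> nat) set \<Rightarrow> nat" where
  "max_degree p E = (MAX v \<in> nodes p. card {u. (u, v) \<in> E} + card {w. (v, w) \<in> E})"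

text \<open>The \<open>m\<close>-th node of the path \<open>xs\<close> is a collider; meaningful for interior positions
  \<open>0 < m < length xs - 1\<close> only.\<close>

definition collider_at :: "(nat \<times> nat) set \<Rightarrow> nat list \<Rightarrow> nat \<Rightarrow> bool" where
  "collider_at E xs m \<longleftrightarrow> (xs ! (m - 1), xs ! m) \<in> E \<and> (xs ! (m + 1), xs ! m) \<in> E"

text \<open>The endpoints of a path can be ignored as noncolliders, since they are never in \<open>S\<close>.\<close>

definition d_separated :: "(nat \<times> nat) set \<Rightarrow> nat \<Rightarrow> nat \<Rightarrow> nat set \<Rightarrow> bool" where
  "d_separated E i j S \<longleftrightarrow>
     (\<forall>xs. skel_path E i xs j \<longrightarrow>
       (\<exists>m. 0 < m \<and> m + 1 < length xs \<and>
          (\<not> collider_at E xs m \<and> xs ! m \<in> S \<or>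
           collider_at E xs m \<and> xs ! m \<notin> S \<and> (\<forall>s \<in> S. (xs ! m, s) \<notin> E\<^sup>+))))"

text \<open>The skeleton is a tree (connected and without cycles), and each edge \<open>i \<rightarrow> j\<close> points away
  from the root \<open>r\<close>: the path in the skeleton from \<open>r\<close> to \<open>j\<close> runs through \<open>i\<close>.\<close>

definition rooted_tree :: "nat \<Rightarrow> (nat \<times> nat) set \<Rightarrow> bool" where
  "rooted_tree p E \<longleftrightarrow>
     dag p E \<and>
     (\<forall>u \<in> nodes p. \<forall>v \<in> nodes p. \<exists>xs. skel_path E u xs v) \<and>
     (\<nexists>xs. skel_cycle E xs) \<and>
     (\<exists>r \<in> nodes p. \<forall>(i, j) \<in> E. \<forall>xs. skel_path E r xs j \<longrightarrow> i \<in> set xs)"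


section \<open>The Gaussian structural equation model\<close>

text \<open>The law \<open>\<N>(0, I)\<close> of the noise vector; the sample point \<open>w\<close> is the noise itself.\<close>

definition noise :: "nat \<Rightarrow> (nat \<Rightarrow> real) measure" where
  "noise p = (\<Pi>\<^sub>M j \<in> nodes p. density lborel (\<lambda>x. ennreal (std_normal_density x)))"

definition coef_mat :: "(nat \<times> nat) set \<Rightarrow> (nat \<times> nat \<Rightarrow> real) \<Rightarrow> nat \<Rightarrow> nat \<Rightarrow> real" where
  "coef_mat E a i j = (if (i, j) \<in> E then a (i, j) else 0)"

fun sem_var :: "(nat \<times> nat) set \<Rightarrow> (nat \<times> nat \<Rightarrow> real) \<Rightarrow> nat \<Rightarrow> (nat \<Rightarrow> real) \<Rightarrow> real" where
  "sem_var E a j w = (\<Sum>i \<in> {1..<j}. coef_mat E a i j * sem_var E a i w) + w j"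

declare sem_var.simps [simp del]

definition sem_sigma ::
  "nat \<Rightarrow> (nat \<times> nat) set \<Rightarrow> (nat \<times> nat \<Rightarrow> real) \<Rightarrow> nat set \<Rightarrow> (nat \<Rightarrow> real) measure" where
  "sem_sigma p E a S =
     vimage_algebra (space (noise p)) (\<lambda>w. \<lambda>k\<in>S. sem_var E a k w) (\<Pi>\<^sub>M k \<in> S. borel)"

text \<open>Conditional covariance of \<open>X\<^sub>i\<close> and \<open>X\<^sub>j\<close> given \<open>X\<^sub>S\<close>, as a random variable. As \<open>X\<close> is
  Gaussian, it is almost surely equal to a constant depending on \<open>a\<close> only.\<close>

definition cond_cov ::
  "nat \<Rightarrow> (nat \<times> nat) set \<Rightarrow> (nat \<times> nat \<Rightarrow> real) \<Rightarrow> nat \<Rightarrow> nat \<Rightarrow> nat set \<Rightarrow> (nat \<Rightarrow> real) \<Rightarrow> real"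
  where
  "cond_cov p E a i j S =
     real_cond_exp (noise p) (sem_sigma p E a S)
       (\<lambda>w. (sem_var E a i w - real_cond_exp (noise p) (sem_sigma p E a S) (sem_var E a i) w) *
            (sem_var E a j w - real_cond_exp (noise p) (sem_sigma p E a S) (sem_var E a j) w))"

definition cond_var ::
  "nat \<Rightarrow> (nat \<times> nat) set \<Rightarrow> (nat \<times> nat \<Rightarrow> real) \<Rightarrow> nat \<Rightarrow> nat set \<Rightarrow> (nat \<Rightarrow> real) \<Rightarrow> real"
  where
  "cond_var p E a i S = cond_cov p E a i i S"


section \<open>Parameters violating strong faithfulness\<close>

definition param_cube :: "(nat \<times> nat) set \<Rightarrow> (nat \<times> nat \<Rightarrow> real) set" where
  "param_cube E = (\<Pi>\<^sub>E e \<in> E. {-1..1})"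

text \<open>Lebesgue measure on \<open>\<real>\<^bsup>E\<^esup>\<close>.\<close>

definition vol :: "(nat \<times> nat) set \<Rightarrow> (nat \<times> nat \<Rightarrow> real) set \<Rightarrow> real" where
  "vol E = measure (completion (\<Pi>\<^sub>M e \<in> E. lborel))"

text \<open>\<open>\<P>\<^sup>\<lambda>\<close> for \<open>i, j\<close> given \<open>S\<close>. Conditional covariances and variances are determined almost
  surely only, hence so is the inequality between them.\<close>

definition P_set ::
  "nat \<Rightarrow> (nat \<times> nat) set \<Rightarrow> real \<Rightarrow> nat \<Rightarrow> nat \<Rightarrow> nat set \<Rightarrow> (nat \<times> nat \<Rightarrow> real) set" where
  "P_set p E l i j S =
     {a \<in> param_cube E.
        AE w in noise p.
          \<bar>cond_cov p E a i j S w\<bar> \<le> l * sqrt (cond_var p E a i S w * cond_var p E a j S w)}"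

definition M_set :: "nat \<Rightarrow> (nat \<times> nat) set \<Rightarrow> real \<Rightarrow> (nat \<times> nat \<Rightarrow> real) set" where
  "M_set p E l =
     \<Union>{P_set p E l i j S | i j S.
         i \<in> nodes p \<and> j \<in> nodes p \<and> i \<noteq> j \<and> S \<subseteq> nodes p - {i, j} \<and> \<not> d_separated E i j S}"

definition N1_set :: "nat \<Rightarrow> (nat \<times> nat) set \<Rightarrow> real \<Rightarrow> (nat \<times> nat \<Rightarrow> real) set" where
  "N1_set p E l =
     \<Union>{P_set p E l i j S | i j S.
         i \<in> nodes p \<and> j \<in> nodes p \<and> i \<noteq> j \<and> S \<subseteq> nodes p - {i, j} \<and> card S \<le> max_degree p E \<and>
         ((i, j) \<in> E \<or>
          \<not> adjacent E i j \<and> \<not> d_separated E i j S \<and> (\<exists>k \<in> nodes p. unshielded_triple E i j k))}"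

definition N2_set :: "nat \<Rightarrow> (nat \<times> nat) set \<Rightarrow> real \<Rightarrow> (nat \<times> nat \<Rightarrow> real) set" where
  "N2_set p E l =
     \<Union>{P_set p E l i j S | i j S.
         (i, j) \<in> E \<and> S \<subseteq> nodes p - {i, j} \<and> card S \<le> max_degree p E}"

end

(* In a tree oriented away from its root, a node has at most one parent. For an edge (i, j) and
   S = pa(i), the residuals of X_i and X_j given X_S are eps_i and a_ij eps_i + eps_j, so the partial
   correlation is a_ij / sqrt (1 + a_ij^2), and every a in the cube with |a_ij| <= lambda is in
   P_{ij|S}. All three sets therefore contain the part of the cube where some |a_e| <= lambda; its
   complement in the cube has volume (2 (1 - lambda))^|E|, and |E| >= p - 1.

   The volume is monotone on measurable sets only, and P_{ij|S} is defined through almost sure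
   classes of conditional expectations for each a separately. Its measurability comes from taking one
   conditional expectation on the product of the parameter cube and the noise space, given a and X_S
   jointly: for almost every a, its section at a is a version of the conditional expectation for the
   parameter a. *)

theory Submission imports Defs begin

section \<open>Sections of conditional expectations\<close>

lemma subalgebra_vimage_algebra:
  assumes "T \<in> measurable N M"
  shows "subalgebra N (vimage_algebra (space N) T M)"
  unfolding subalgebra_def using sets_image_in_sets[OF refl assms] by simp

text \<open>Dynkin's argument: the sets \<open>B\<close> with vanishing integral are closed under
  complements and countable disjoint unions, hence include everything generated by the
  intersection-stable family \<open>C\<close>. In the use below, \<open>C\<close> is countable, so
  only countably many null sets of parameters have to be discarded.\<close>

lemma integral_vanishes_on_generated_sigma_algebra:
  fixes h :: "'b \<Rightarrow> real"
  assumes h: "integrable N h" and T: "T \<in> measurable N M"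
    and C: "Int_stable C" "C \<subseteq> Pow (space M)" "space M \<in> C"
    and gen: "sets M = sigma_sets (space M) C"
    and zero: "\<And>B. B \<in> C \<Longrightarrow> (\<integral>w. indicator B (T w) * h w \<partial>N) = 0"
    and B: "B \<in> sets M"
  shows "(\<integral>w. indicator B (T w) * h w \<partial>N) = 0"
proof -
  have int: "integrable N (\<lambda>w. indicator B (T w) * h w)" if "B \<in> sets M" for B
  proof -
    have "indicator B (T w) = (indicator (T -` B \<inter> space N) w :: real)" if "w \<in> space N" for w
      using that by (simp add: indicator_def)
    then show ?thesis
      using integrable_mult_indicator[OF measurable_sets[OF T that] h]
      by (simp cong: Bochner_Integration.integrable_cong)
  qed
  have Tsp: "T w \<in> space M" if "w \<in> space N" for w
    using T that by (rule measurable_space)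
  \<comment> \<open>The whole space is in \<open>C\<close>, so \<open>h\<close> itself integrates to
    0; this is what closes the family under complements.\<close>
  have total: "(\<integral>w. h w \<partial>N) = 0"
    using zero[OF C(3)] Tsp by (simp cong: Bochner_Integration.integral_cong)
  have "B \<in> sigma_sets (space M) C" using B gen by simp
  then show ?thesis
  proof (induction rule: sigma_sets_induct_disjoint[OF C(1,2), consumes 1, case_names basic empty compl union])
    case (basic A) then show ?case by (rule zero)
  next
    case empty then show ?case by simp
  next
    case (compl A)
    have A: "A \<in> sets M" using compl gen by simp
    have "(\<integral>w. indicator (space M - A) (T w) * h w \<partial>N) = (\<integral>w. h w - indicator A (T w) * h w \<partial>N)"
      by (intro Bochner_Integration.integral_cong) (auto simp: indicator_def Tsp)
    also have "\<dots> = 0"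
      using compl total h int[OF A] by simp
    finally show ?case .
  next
    case (union A)
    have A: "A i \<in> sets M" for i using union gen by auto
    have "(\<lambda>i. \<integral>w. indicator (A i) (T w) * h w \<partial>N) sums
          (\<integral>w. indicator (\<Union>i. A i) (T w) * h w \<partial>N)"
    proof -
      have meas: "(\<lambda>w. indicator (A i) (T w) * h w) \<in> borel_measurable N" for i
        using int[OF A] by auto
      have sm: "(\<lambda>i. indicator (A i) (T w) * h w) sums (indicator (\<Union>i. A i) (T w) * h w)" for w
        by (intro sums_mult2 indicator_sums) (use union(1) in \<open>auto simp: disjoint_family_on_def\<close>)
      have sn: "(\<lambda>i. norm (indicator (A i) (T w) * h w)) sums (indicator (\<Union>i. A i) (T w) * \<bar>h w\<bar>)" for w
      proof -
        have "(\<lambda>i. indicator (A i) (T w) * \<bar>h w\<bar>) sums (indicator (\<Union>i. A i) (T w) * \<bar>h w\<bar>)"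
          by (intro sums_mult2 indicator_sums) (use union(1) in \<open>auto simp: disjoint_family_on_def\<close>)
        then show ?thesis by (simp add: abs_mult)
      qed
      \<comment> \<open>The \<open>A i\<close> are disjoint, so at most one summand is nonzero at
        \<open>w\<close>, and \<open>norm (h w)\<close> dominates all partial sums.\<close>
      have bnd: "norm (\<Sum>i<n. indicator (A i) (T w) * h w) \<le> norm (h w)" for n w
      proof -
        have "norm (\<Sum>i<n. indicator (A i) (T w) * h w) \<le> (\<Sum>i<n. norm (indicator (A i) (T w) * h w))"
          by (rule norm_sum)
        also have "\<dots> \<le> indicator (\<Union>i. A i) (T w) * \<bar>h w\<bar>"
          using sum_le_suminf[OF sums_summable[OF sn[of w]], of "{..<n}"] sums_unique[OF sn[of w]] by simp
        also have "\<dots> \<le> norm (h w)" by (simp add: indicator_def)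
        finally show ?thesis .
      qed
      have "(\<lambda>n. \<integral>w. (\<Sum>i<n. indicator (A i) (T w) * h w) \<partial>N) \<longlonglongrightarrow>
            (\<integral>w. indicator (\<Union>i. A i) (T w) * h w \<partial>N)"
      proof (rule integral_dominated_convergence[where w="\<lambda>w. norm (h w)"])
        show "AE w in N. (\<lambda>n. \<Sum>i<n. indicator (A i) (T w) * h w) \<longlonglongrightarrow> indicator (\<Union>i. A i) (T w) * h w"
          using sm by (simp add: sums_def)
        show "(\<lambda>w. indicator (\<Union>i. A i) (T w) * h w) \<in> borel_measurable N"
          using int[of "\<Union>i. A i"] A by auto
        show "(\<lambda>w. \<Sum>i<n. indicator (A i) (T w) * h w) \<in> borel_measurable N" for n
          by (intro borel_measurable_sum meas)
        show "integrable N (\<lambda>w. norm (h w))" using h by (rule integrable_norm)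
        show "AE w in N. norm (\<Sum>i<n. indicator (A i) (T w) * h w) \<le> norm (h w)" for n
          by (intro AE_I2 bnd)
      qed
      moreover have "(\<integral>w. (\<Sum>i<n. indicator (A i) (T w) * h w) \<partial>N) =
          (\<Sum>i<n. \<integral>w. indicator (A i) (T w) * h w \<partial>N)" for n
        by (rule Bochner_Integration.integral_sum) (rule int[OF A])
      ultimately show ?thesis
        unfolding sums_def by (simp only:)
    qed
    then have "(\<lambda>i. 0) sums (\<integral>w. indicator (\<Union>i. A i) (T w) * h w \<partial>N)"
      by (simp only: union(3))
    from sums_unique2[OF this sums_zero] show ?case .
  qed
qed

lemma set_integrableI:
  fixes f :: "'a \<Rightarrow> 'b::{banach, second_countable_topology}"
  shows "A \<in> sets M \<Longrightarrow> integrable M f \<Longrightarrow> set_integrable M A f"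
  unfolding set_integrable_def by (rule integrable_mult_indicator)

text \<open>The joint conditional expectation \<open>g\<close> satisfies the averaging identity on
  all events "a in A and T in B". Letting \<open>A\<close> vary turns it into an identity on the
  section at almost every \<open>a\<close>, for one fixed \<open>B\<close>. Countability of
  \<open>C\<close> makes the null set independent of \<open>B\<close>, and the preceding lemma
  passes from \<open>C\<close> to all measurable \<open>B\<close>.\<close>

lemma real_cond_exp_section:
  fixes Q :: "'a measure" and N :: "'b measure" and M :: "'c measure" and f :: "'a \<times> 'b \<Rightarrow> real"
  assumes "finite_measure Q" and "finite_measure N"
    and C: "countable C" "Int_stable C" "C \<subseteq> Pow (space M)" "space M \<in> C"
    and gen: "sets M = sigma_sets (space M) C"
    and T [measurable]: "T \<in> measurable (Q \<Otimes>\<^sub>M N) M"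
    and f [measurable]: "integrable (Q \<Otimes>\<^sub>M N) f"
  shows "AE a in Q. AE w in N.
    real_cond_exp N (vimage_algebra (space N) (\<lambda>w. T (a, w)) M) (\<lambda>w. f (a, w)) w =
    real_cond_exp (Q \<Otimes>\<^sub>M N)
      (vimage_algebra (space (Q \<Otimes>\<^sub>M N)) (\<lambda>z. (fst z, T z)) (Q \<Otimes>\<^sub>M M)) f (a, w)"
proof -
  interpret Q: finite_measure Q by fact
  interpret N: finite_measure N by fact
  interpret QN: pair_sigma_finite Q N ..
  interpret R: finite_measure "Q \<Otimes>\<^sub>M N" by (intro finite_measure_pair_measure) fact+
  define G where "G = vimage_algebra (space (Q \<Otimes>\<^sub>M N)) (\<lambda>z. (fst z, T z)) (Q \<Otimes>\<^sub>M M)"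
  define g where "g = real_cond_exp (Q \<Otimes>\<^sub>M N) G f"
  have pairm: "(\<lambda>z. (fst z, T z)) \<in> measurable (Q \<Otimes>\<^sub>M N) (Q \<Otimes>\<^sub>M M)" by measurable
  have subG: "subalgebra (Q \<Otimes>\<^sub>M N) G"
    unfolding G_def using pairm by (rule subalgebra_vimage_algebra)
  interpret G: finite_measure_subalgebra "Q \<Otimes>\<^sub>M N" G
    by unfold_locales fact
  have gG: "g \<in> borel_measurable G" unfolding g_def by simp
  have gint [measurable]: "integrable (Q \<Otimes>\<^sub>M N) g"
    unfolding g_def by (rule G.real_cond_exp_int(1)[OF f])
  have setsC: "B \<in> sets M" if "B \<in> C" for B using that gen by auto
  \<comment> \<open>Both sides are integrable functions of \<open>a\<close>; they agree almost
    everywhere because their integrals over every measurable \<open>A\<close> agree.\<close>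
  have key: "AE a in Q. (\<integral>w. indicator B (T (a, w)) * (f (a, w) - g (a, w)) \<partial>N) = 0" if "B \<in> C" for B
  proof (rule density_unique_real)
    have [measurable]: "B \<in> sets M" by (rule setsC) fact
    have int: "integrable (Q \<Otimes>\<^sub>M N) (\<lambda>z. indicator B (T z) * (f z - g z))"
      by (rule Bochner_Integration.integrable_bound[where f="\<lambda>z. f z - g z"])
         (use f gint in \<open>auto simp: indicator_def\<close>)
    show "integrable Q (\<lambda>a. \<integral>w. indicator B (T (a, w)) * (f (a, w) - g (a, w)) \<partial>N)"
      using QN.integrable_fst'[OF int] by simp
    show "integrable Q (\<lambda>_. 0::real)" by simp
    fix A assume A [measurable]: "A \<in> sets Q"
    let ?D = "(\<lambda>z. (fst z, T z)) -` (A \<times> B) \<inter> space (Q \<Otimes>\<^sub>M N)"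
    \<comment> \<open>The event is the preimage of a rectangle under the map generating
      \<open>G\<close>, so \<open>f\<close> and \<open>g\<close> have the same integral over
      it.\<close>
    have D: "?D \<in> sets G" unfolding G_def by (intro in_vimage_algebra) measurable
    have DR: "?D \<in> sets (Q \<Otimes>\<^sub>M N)" using D subG unfolding subalgebra_def by auto
    have int2: "integrable (Q \<Otimes>\<^sub>M N) (\<lambda>z. indicator A (fst z) * (indicator B (T z) * (f z - g z)))"
      by (rule Bochner_Integration.integrable_bound[OF int]) (use int in \<open>auto simp: indicator_def\<close>)
    have "(LINT a:A|Q. \<integral>w. indicator B (T (a, w)) * (f (a, w) - g (a, w)) \<partial>N) =
          (\<integral>a. (\<integral>w. indicator A (fst (a, w)) * (indicator B (T (a, w)) * (f (a, w) - g (a, w))) \<partial>N) \<partial>Q)"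
      unfolding set_lebesgue_integral_def by simp
    also have "\<dots> = (\<integral>z. indicator A (fst z) * (indicator B (T z) * (f z - g z)) \<partial>(Q \<Otimes>\<^sub>M N))"
      by (rule QN.integral_fst'[OF int2])
    also have "\<dots> = (LINT z:?D|(Q \<Otimes>\<^sub>M N). f z - g z)"
      unfolding set_lebesgue_integral_def
      by (intro Bochner_Integration.integral_cong) (auto simp: indicator_def)
    also have "\<dots> = (LINT z:?D|(Q \<Otimes>\<^sub>M N). f z) - (LINT z:?D|(Q \<Otimes>\<^sub>M N). g z)"
      by (intro set_integral_diff set_integrableI[OF DR] f gint)
    also have "\<dots> = 0" unfolding g_def using G.real_cond_exp_intA[OF f D] by simp
    finally show "(LINT a:A|Q. \<integral>w. indicator B (T (a, w)) * (f (a, w) - g (a, w)) \<partial>N) =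
      (LINT a:A|Q. 0)" by (simp add: set_lebesgue_integral_def)
  qed
  have "AE a in Q. \<forall>B\<in>C. (\<integral>w. indicator B (T (a, w)) * (f (a, w) - g (a, w)) \<partial>N) = 0"
    using C(1) key by (simp add: AE_ball_countable)
  moreover have "AE a in Q. integrable N (\<lambda>w. f (a, w))" by (rule QN.AE_integrable_fst'[OF f])
  moreover have "AE a in Q. integrable N (\<lambda>w. g (a, w))" by (rule QN.AE_integrable_fst'[OF gint])
  moreover have "AE a in Q. a \<in> space Q" by simp
  ultimately show ?thesis
    unfolding G_def[symmetric] g_def[symmetric]
  proof eventually_elim
    case (elim a)
    let ?F = "vimage_algebra (space N) (\<lambda>w. T (a, w)) M"
    have Ta: "(\<lambda>w. T (a, w)) \<in> measurable N M" using elim(4) by measurable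
    have "subalgebra N ?F"
      using Ta by (rule subalgebra_vimage_algebra)
    then interpret F: finite_measure_subalgebra N ?F by unfold_locales
    show ?case
    proof (rule F.real_cond_exp_charact)
      fix A assume "A \<in> sets ?F"
      then obtain B where B: "B \<in> sets M" and A: "A = (\<lambda>w. T (a, w)) -` B \<inter> space N"
        using measurable_space[OF Ta] by (auto simp: sets_vimage_algebra2)
      have AN: "A \<in> sets N" unfolding A by (rule measurable_sets[OF Ta B])
      have "(\<integral>w. indicator B (T (a, w)) * (f (a, w) - g (a, w)) \<partial>N) = 0"
        by (rule integral_vanishes_on_generated_sigma_algebra[OF _ Ta C(2,3,4) gen _ B])
           (use elim in auto)
      also have "(\<integral>w. indicator B (T (a, w)) * (f (a, w) - g (a, w)) \<partial>N) =
                 (LINT w:A|N. f (a, w) - g (a, w))"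
        unfolding set_lebesgue_integral_def A
        by (intro Bochner_Integration.integral_cong) (auto simp: indicator_def)
      also have "\<dots> = (LINT w:A|N. f (a, w)) - (LINT w:A|N. g (a, w))"
        by (intro set_integral_diff set_integrableI[OF AN] elim)
      finally show "(LINT w:A|N. f (a, w)) = (LINT w:A|N. g (a, w))" by simp
    next
      \<comment> \<open>With \<open>a\<close> fixed, the first generating coordinate is constant and
        the second is \<open>T (a, w)\<close>; hence the section of a \<open>G\<close>-measurable
        function is \<open>?F\<close>-measurable.\<close>
      have "(\<lambda>w. (a, w)) \<in> measurable ?F G"
        unfolding G_def
      proof (rule measurable_vimage_algebra2)
        show "Pair a \<in> space ?F \<rightarrow> space (Q \<Otimes>\<^sub>M N)" using elim by (auto simp: space_pair_measure)
        have "(\<lambda>w. T (a, w)) \<in> measurable ?F M"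
          by (rule measurable_vimage_algebra1) (use measurable_space[OF Ta] in auto)
        then show "(\<lambda>w. (fst (a, w), T (a, w))) \<in> measurable ?F (Q \<Otimes>\<^sub>M M)"
          using elim by simp
      qed
      from measurable_compose[OF this gG] show "(\<lambda>w. g (a, w)) \<in> borel_measurable ?F" .
    qed (use elim in auto)
  qed
qed

text \<open>The generator consists of the finite intersections of half-spaces with rational
  thresholds; countably many coordinates and thresholds keep it countable.\<close>

lemma PiM_borel_countable_generator:
  assumes "countable S"
  obtains C where "countable C" "Int_stable C" "C \<subseteq> Pow (space (\<Pi>\<^sub>M k\<in>S. (borel :: real measure)))"
    "space (\<Pi>\<^sub>M k\<in>S. (borel :: real measure)) \<in> C"
    "sets (\<Pi>\<^sub>M k\<in>S. (borel :: real measure)) = sigma_sets (space (\<Pi>\<^sub>M k\<in>S. (borel :: real measure))) C"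
proof -
  let ?M = "\<Pi>\<^sub>M k\<in>S. (borel :: real measure)"
  let ?\<Omega> = "space ?M"
  define H where "H = (\<lambda>(k, q). {x \<in> ?\<Omega>. x k \<le> q}) ` (S \<times> \<rat>)"
  \<comment> \<open>Intersecting with \<open>?\<Omega>\<close> makes the empty family yield the
    whole space, as \<open>\<Inter>{}\<close> alone would be \<open>UNIV\<close>.\<close>
  define C where "C = (\<lambda>F. ?\<Omega> \<inter> \<Inter>F) ` {F. F \<subseteq> H \<and> finite F}"
  have "countable H" unfolding H_def using assms countable_rat by auto
  then have 1: "countable C" unfolding C_def
    using countable_Collect_finite_subset[of H] by (intro countable_image) (simp add: conj_commute)
  have 2: "Int_stable C"
  proof (rule Int_stableI)
    fix a b assume "a \<in> C" "b \<in> C"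
    then obtain F F' where "a = ?\<Omega> \<inter> \<Inter>F" "b = ?\<Omega> \<inter> \<Inter>F'" "F \<subseteq> H" "finite F" "F' \<subseteq> H" "finite F'"
      unfolding C_def by auto
    then have "a \<inter> b = ?\<Omega> \<inter> \<Inter>(F \<union> F')" "F \<union> F' \<subseteq> H" "finite (F \<union> F')" by auto
    then show "a \<inter> b \<in> C" unfolding C_def by blast
  qed
  have 3: "C \<subseteq> Pow ?\<Omega>" unfolding C_def by auto
  have 4: "?\<Omega> \<in> C" unfolding C_def by (rule image_eqI[of _ _ "{}"]) auto
  have Hsets: "B \<in> sets ?M" if "B \<in> H" for B
    using that unfolding H_def by auto
  have Csets: "C \<subseteq> sets ?M"
  proof
    fix B assume "B \<in> C"
    then obtain F where F: "B = ?\<Omega> \<inter> \<Inter>F" "F \<subseteq> H" "finite F" unfolding C_def by auto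
    from F(3,2) have "?\<Omega> \<inter> \<Inter>F \<in> sets ?M"
    proof (induction F rule: finite_induct)
      case (insert x F)
      have "?\<Omega> \<inter> \<Inter>(insert x F) = x \<inter> (?\<Omega> \<inter> \<Inter>F)" by auto
      then show ?case using insert Hsets by auto
    qed simp
    then show "B \<in> sets ?M" using F by simp
  qed
  have single: "{x \<in> ?\<Omega>. x k \<le> c} \<in> sigma_sets ?\<Omega> C" if "k \<in> S" for k c
  proof -
    interpret sigma_algebra ?\<Omega> "sigma_sets ?\<Omega> C" using 3 by (rule sigma_algebra_sigma_sets)
    have q: "{x \<in> ?\<Omega>. x k \<le> q} \<in> sigma_sets ?\<Omega> C" if "q \<in> \<rat>" for q
    proof (rule sigma_sets.Basic)
      have "{x \<in> ?\<Omega>. x k \<le> q} \<in> H" unfolding H_def using that \<open>k \<in> S\<close> by force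
      then show "{x \<in> ?\<Omega>. x k \<le> q} \<in> C"
        unfolding C_def by (intro image_eqI[of _ _ "{{x \<in> ?\<Omega>. x k \<le> q}}"]) auto
    qed
    \<comment> \<open>A real threshold is reached from above through countably many rational
      ones.\<close>
    have "{x \<in> ?\<Omega>. x k \<le> c} = (\<Inter>q\<in>{q\<in>\<rat>. c \<le> q}. {x \<in> ?\<Omega>. x k \<le> q})" (is "?l = ?r")
    proof
      show "?r \<subseteq> ?l"
      proof
        fix x assume x: "x \<in> ?r"
        obtain q0 where "q0 \<in> \<rat>" "c < q0" using Rats_dense_in_real[of c "c + 1"] by auto
        then have "x \<in> ?\<Omega>" using x by (auto dest!: bspec[of _ _ q0])
        moreover have "x k \<le> c"
        proof (rule ccontr)
          assume "\<not> x k \<le> c"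
          then obtain q where "q \<in> \<rat>" "c < q" "q < x k" using Rats_dense_in_real[of c "x k"] by auto
          with x show False by (auto dest!: bspec[of _ _ q])
        qed
        ultimately show "x \<in> ?l" by simp
      qed
    qed auto
    moreover have "\<dots> \<in> sigma_sets ?\<Omega> C"
    proof (rule countable_INT')
      show "countable {q \<in> \<rat>. c \<le> q}" using countable_rat by (rule countable_subset[rotated]) auto
      show "{q \<in> \<rat>. c \<le> q} \<noteq> {}"
        using Rats_dense_in_real[of c "c + 1"] by (auto intro: less_imp_le)
    qed (use q in auto)
    ultimately show ?thesis by simp
  qed
  \<comment> \<open>Measurability of the identity, checked coordinate by coordinate, says that
    \<open>C\<close> generates the whole product sigma-algebra.\<close>
  have "(\<lambda>x. x) \<in> measurable (sigma ?\<Omega> C) ?M"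
  proof (rule measurable_PiM_single')
    show "(\<lambda>x. x k) \<in> borel_measurable (sigma ?\<Omega> C)" if "k \<in> S" for k
      using single[OF that] 3 by (simp add: borel_measurable_iff_le)
  qed (use 3 in \<open>auto simp: space_PiM\<close>)
  then have "sets ?M \<subseteq> sigma_sets ?\<Omega> C"
    using 3 by (auto dest!: measurable_sets simp: sets.Int_space_eq2)
  moreover have "sigma_sets ?\<Omega> C \<subseteq> sets ?M" using Csets by (rule sets.sigma_sets_subset)
  ultimately show thesis using that[OF 1 2 3 4] by blast
qed

section \<open>Square integrable functions\<close>

text \<open>Membership in L^2. The class is stable under sums and conditional expectations, and
  products of two members are integrable, as the products of residuals in \<open>cond_cov\<close>
  must be.\<close>

definition square_integrable :: "'a measure \<Rightarrow> ('a \<Rightarrow> real) \<Rightarrow> bool" where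
  "square_integrable M f \<longleftrightarrow> f \<in> borel_measurable M \<and> integrable M (\<lambda>x. (f x)\<^sup>2)"

lemma square_integrable_mult:
  assumes "square_integrable M f" "square_integrable M g"
  shows "integrable M (\<lambda>x. f x * g x)"
proof (rule Bochner_Integration.integrable_bound[where f="\<lambda>x. (f x)\<^sup>2 + (g x)\<^sup>2"])
  have "\<bar>a * b\<bar> \<le> a\<^sup>2 + b\<^sup>2" for a b :: real
  proof -
    have "2 * (\<bar>a\<bar> * \<bar>b\<bar>) \<le> a\<^sup>2 + b\<^sup>2"
      using sum_squares_bound[of "\<bar>a\<bar>" "\<bar>b\<bar>"] by (simp add: mult.assoc)
    moreover have "0 \<le> \<bar>a\<bar> * \<bar>b\<bar>" by simp
    ultimately show ?thesis unfolding abs_mult by linarith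
  qed
  then show "AE x in M. norm (f x * g x) \<le> norm ((f x)\<^sup>2 + (g x)\<^sup>2)" by simp
qed (use assms in \<open>auto simp: square_integrable_def\<close>)

lemma square_integrable_add:
  assumes f: "square_integrable M f" and g: "square_integrable M g"
  shows "square_integrable M (\<lambda>x. f x + g x)"
  using assms square_integrable_mult[OF f g]
  by (auto simp: square_integrable_def power2_sum mult.assoc)

lemma square_integrable_diff:
  assumes f: "square_integrable M f" and g: "square_integrable M g"
  shows "square_integrable M (\<lambda>x. f x - g x)"
  using assms square_integrable_mult[OF f g]
  by (auto simp: square_integrable_def power2_diff mult.assoc)

lemma square_integrable_zero [simp]: "square_integrable M (\<lambda>x. 0)"
  by (simp add: square_integrable_def)

lemma square_integrable_sum:
  assumes "\<And>i. i \<in> I \<Longrightarrow> square_integrable M (f i)"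
  shows "square_integrable M (\<lambda>x. \<Sum>i\<in>I. f i x)"
  using assms by (induction I rule: infinite_finite_induct) (auto intro: square_integrable_add)

text \<open>Serves for products with a coefficient that varies with the parameter but is at most 1
  in absolute value on the cube.\<close>

lemma square_integrable_bound:
  assumes "square_integrable M f" "g \<in> borel_measurable M"
    and "\<And>x. x \<in> space M \<Longrightarrow> \<bar>g x\<bar> \<le> \<bar>f x\<bar>"
  shows "square_integrable M g"
  unfolding square_integrable_def
proof
  show "integrable M (\<lambda>x. (g x)\<^sup>2)"
  proof (rule Bochner_Integration.integrable_bound[where f="\<lambda>x. (f x)\<^sup>2"])
    show "AE x in M. norm ((g x)\<^sup>2) \<le> norm ((f x)\<^sup>2)"
      using assms(3) by (auto simp: abs_le_square_iff)
  qed (use assms in \<open>auto simp: square_integrable_def\<close>)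
qed (use assms in simp)

lemma (in finite_measure) square_integrable_integrable:
  "square_integrable M f \<Longrightarrow> integrable M f"
  unfolding square_integrable_def by (blast intro: square_integrable_imp_integrable)

text \<open>Conditional Jensen inequality for the convex function \<open>x\<^sup>2\<close>.\<close>

lemma (in finite_measure_subalgebra) square_integrable_real_cond_exp:
  assumes "square_integrable M f"
  shows "square_integrable M (real_cond_exp M F f)"
proof -
  have "integrable M (\<lambda>x. (real_cond_exp M F f x)\<^sup>2)"
  proof (rule integrable_convex_cond_exp[where I=UNIV])
    show "integrable M f" using assms by (rule square_integrable_integrable)
    show "convex_on UNIV (\<lambda>x::real. x\<^sup>2)"
      using convex_power2 by simp
  qed (use assms in \<open>auto simp: square_integrable_def\<close>)
  then show ?thesis by (simp add: square_integrable_def)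
qed

section \<open>The noise\<close>

abbreviation std_normal :: "real measure" where
  "std_normal \<equiv> density lborel (\<lambda>x. ennreal (std_normal_density x))"

lemma prob_space_std_normal: "prob_space std_normal"
  by (rule prob_space_normal_density) simp

lemma prob_space_noise: "prob_space (noise p)"
  unfolding noise_def by (intro prob_space_PiM prob_space_std_normal)

lemma sets_noise [measurable_cong]: "sets (noise p) = sets (\<Pi>\<^sub>M j\<in>nodes p. borel)"
  unfolding noise_def by (intro sets_PiM_cong) auto

lemma finite_nodes [simp]: "finite (nodes p)"
  by (simp add: nodes_def)

lemma distr_noise:
  assumes "j \<in> nodes p"
  shows "distr (noise p) borel (\<lambda>w. w j) = std_normal"
proof -
  have "distr (noise p) borel (\<lambda>w. w j) = distr (noise p) std_normal (\<lambda>w. w j)"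
    by (intro distr_cong) auto
  also have "\<dots> = std_normal"
    unfolding noise_def by (rule distr_PiM_component[OF prob_space_std_normal assms])
  finally show ?thesis .
qed

lemma std_normal_moment:
  shows "integrable std_normal (\<lambda>x. x ^ k)"
    and "(\<integral>x. x \<partial>std_normal) = 0" and "(\<integral>x. x\<^sup>2 \<partial>std_normal) = 1"
proof -
  show "integrable std_normal (\<lambda>x. x ^ k)"
    using integrable_std_normal_moment[of k] by (simp add: integrable_density)
  show "(\<integral>x. x \<partial>std_normal) = 0"
    using integral_std_normal_moment_odd[of 0] by (simp add: integral_density)
  \<comment> \<open>The moment of order 2k is (2k)! / (2^k k!), which is 1 for k = 1.\<close>
  show "(\<integral>x. x\<^sup>2 \<partial>std_normal) = 1"
    using integral_std_normal_moment_even[of 1] by (simp add: integral_density fact_2)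
qed

lemma noise_moment:
  assumes j: "j \<in> nodes p"
  shows "integrable (noise p) (\<lambda>w. (w j) ^ k)"
    and "(\<integral>w. w j \<partial>noise p) = 0" and "(\<integral>w. (w j)\<^sup>2 \<partial>noise p) = 1"
proof -
  have m: "(\<lambda>w. w j) \<in> borel_measurable (noise p)" using j by measurable
  show "integrable (noise p) (\<lambda>w. (w j) ^ k)"
    using integrable_distr[OF m, of "\<lambda>x. x ^ k"] std_normal_moment(1) by (simp add: distr_noise[OF j])
  show "(\<integral>w. w j \<partial>noise p) = 0"
    using integral_distr[OF m, of "\<lambda>x. x"] std_normal_moment(2) by (simp add: distr_noise[OF j])
  show "(\<integral>w. (w j)\<^sup>2 \<partial>noise p) = 1"
    using integral_distr[OF m, of "\<lambda>x. x\<^sup>2"] std_normal_moment(3) by (simp add: distr_noise[OF j])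
qed

lemma square_integrable_noise:
  assumes "j \<in> nodes p" shows "square_integrable (noise p) (\<lambda>w. w j)"
proof -
  have "(\<lambda>w. w j) \<in> borel_measurable (noise p)" using assms by measurable
  then show ?thesis using noise_moment(1)[OF assms, of 2] by (simp add: square_integrable_def)
qed

text \<open>Independence amounts to the joint law being the product of the marginals, and
  \<open>noise p\<close> is such a product by construction.\<close>

lemma indep_vars_noise:
  assumes "nodes p \<noteq> {}"
  shows "prob_space.indep_vars (noise p) (\<lambda>_. borel) (\<lambda>j w. w j) (nodes p)"
proof -
  interpret prob_space "noise p" by (rule prob_space_noise)
  have m: "(\<lambda>w. w j) \<in> borel_measurable (noise p)" if "j \<in> nodes p" for j using that by measurable
  have sp: "space (noise p) = (\<Pi>\<^sub>E j\<in>nodes p. UNIV)" by (simp add: noise_def space_PiM)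
  have "distr (noise p) (\<Pi>\<^sub>M j\<in>nodes p. borel) (\<lambda>w. \<lambda>j\<in>nodes p. w j) = noise p"
  proof -
    \<comment> \<open>Points of the space are extensional on \<open>nodes p\<close>, so restricting
      them changes nothing.\<close>
    have "distr (noise p) (\<Pi>\<^sub>M j\<in>nodes p. borel) (\<lambda>w. \<lambda>j\<in>nodes p. w j) = distr (noise p) (noise p) (\<lambda>w. w)"
      by (intro distr_cong) (auto simp: sets_noise sp)
    then show ?thesis by simp
  qed
  also have "noise p = (\<Pi>\<^sub>M j\<in>nodes p. distr (noise p) borel (\<lambda>w. w j))"
    unfolding noise_def[of p]
    by (intro PiM_cong refl) (simp add: distr_noise flip: noise_def)
  finally show ?thesis
    using indep_vars_iff_distr_eq_PiM'[OF assms, where M'="\<lambda>_. borel" and X="\<lambda>j w. w j"] m by simp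
qed

section \<open>The structural equation model\<close>

text \<open>Induction along the topological order. Measurability jointly in parameter and noise is
  what permits conditional expectations on the product space.\<close>

lemma measurable_sem_var [measurable]:
  assumes "j \<in> nodes p"
  shows "(\<lambda>z. sem_var E (fst z) j (snd z)) \<in> borel_measurable ((\<Pi>\<^sub>M e\<in>E. borel) \<Otimes>\<^sub>M noise p)"
  using assms
proof (induction j rule: less_induct)
  case (less j)
  have [measurable]: "(\<lambda>z. coef_mat E (fst z) i j) \<in> borel_measurable ((\<Pi>\<^sub>M e\<in>E. borel) \<Otimes>\<^sub>M noise p)" for i
    unfolding coef_mat_def by (cases "(i, j) \<in> E") simp_all
  have [measurable]: "(\<lambda>z. sem_var E (fst z) i (snd z)) \<in> borel_measurable ((\<Pi>\<^sub>M e\<in>E. borel) \<Otimes>\<^sub>M noise p)"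
    if "i \<in> {1..<j}" for i
    using that less by (intro less.IH) (auto simp: nodes_def)
  have [measurable]: "(\<lambda>z. snd z j) \<in> borel_measurable ((\<Pi>\<^sub>M e\<in>E. borel) \<Otimes>\<^sub>M noise p)"
    using less.prems by measurable
  show ?case
    unfolding sem_var.simps[of E _ j] by measurable
qed

text \<open>The restriction, rather than a density, makes the bound on the coefficients hold everywhere
  on the space.\<close>

definition param_measure :: "(nat \<times> nat) set \<Rightarrow> (nat \<times> nat \<Rightarrow> real) measure" where
  "param_measure E = restrict_space (\<Pi>\<^sub>M e\<in>E. lborel) (param_cube E)"

lemma param_cube_sets:
  assumes "finite E" shows "param_cube E \<in> sets (\<Pi>\<^sub>M e\<in>E. lborel)"
  unfolding param_cube_def using assms by (intro sets_PiM_I_finite) auto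

lemma space_param_measure: "space (param_measure E) = param_cube E"
  unfolding param_measure_def space_restrict_space by (auto simp: param_cube_def space_PiM PiE_iff)

lemma finite_param_measure:
  assumes "finite E" shows "finite_measure (param_measure E)"
proof
  interpret finite_product_sigma_finite "\<lambda>_. lborel :: real measure" E
    by unfold_locales (rule assms)
  have "emeasure (param_measure E) (space (param_measure E)) = emeasure (\<Pi>\<^sub>M e\<in>E. lborel) (param_cube E)"
    using param_cube_sets[OF assms] unfolding space_param_measure unfolding param_measure_def
    by (intro emeasure_restrict_space) (auto simp: Int_absorb2 sets.sets_into_space)
  also have "\<dots> = (\<Prod>e\<in>E. emeasure lborel {-1..1::real})"
    unfolding param_cube_def by (rule measure_times) auto
  also have "\<dots> \<noteq> \<infinity>" by (simp add: ennreal_prod_eq_top power_eq_top_ennreal)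
  finally show "emeasure (param_measure E) (space (param_measure E)) \<noteq> \<infinity>" .
qed

section \<open>Square integrability on the product of parameters and noise\<close>

lemma measurable_param_pair:
  assumes "f \<in> borel_measurable ((\<Pi>\<^sub>M e\<in>E. borel) \<Otimes>\<^sub>M N)"
  shows "f \<in> borel_measurable (param_measure E \<Otimes>\<^sub>M N)"
proof -
  have "fst \<in> measurable (param_measure E \<Otimes>\<^sub>M N) (\<Pi>\<^sub>M e\<in>E. borel)"
  proof (rule measurable_compose[OF measurable_fst])
    have "(\<lambda>x. x) \<in> measurable (\<Pi>\<^sub>M e\<in>E. (lborel :: real measure)) (\<Pi>\<^sub>M e\<in>E. borel)"
      by (intro measurable_ident_sets sets_PiM_cong) auto
    then show "(\<lambda>x. x) \<in> measurable (param_measure E) (\<Pi>\<^sub>M e\<in>E. borel)"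
      unfolding param_measure_def by (rule measurable_restrict_space1)
  qed
  then have "(\<lambda>z. (fst z, snd z)) \<in> measurable (param_measure E \<Otimes>\<^sub>M N) ((\<Pi>\<^sub>M e\<in>E. borel) \<Otimes>\<^sub>M N)"
    by (intro measurable_Pair measurable_snd)
  from measurable_compose[OF this assms] show ?thesis by simp
qed

lemma square_integrable_snd:
  assumes "finite_measure Q" "prob_space N" "square_integrable N f"
  shows "square_integrable (Q \<Otimes>\<^sub>M N) (\<lambda>z. f (snd z))"
proof -
  interpret Q: finite_measure Q by fact
  interpret N: prob_space N by fact
  interpret pair_sigma_finite Q N ..
  have [measurable]: "f \<in> borel_measurable N" and i: "integrable N (\<lambda>x. (f x)\<^sup>2)"
    using assms(3) by (auto simp: square_integrable_def)
  have "integrable (Q \<Otimes>\<^sub>M N) (\<lambda>z. (f (snd z))\<^sup>2)"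
    by (rule Fubini_integrable) (use i in simp_all)
  then show ?thesis by (simp add: square_integrable_def)
qed

text \<open>Induction along the topological order. The coefficients are functions on the product
  space here; being bounded by 1 on the cube, they preserve square integrability.\<close>

lemma square_integrable_sem_var:
  assumes E: "finite E" and "j \<in> nodes p"
  shows "square_integrable (param_measure E \<Otimes>\<^sub>M noise p) (\<lambda>z. sem_var E (fst z) j (snd z))"
  using assms(2)
proof (induction j rule: less_induct)
  case (less j)
  have IH: "square_integrable (param_measure E \<Otimes>\<^sub>M noise p) (\<lambda>z. sem_var E (fst z) i (snd z))"
    if "i \<in> {1..<j}" for i
    using that less by (intro less.IH) (auto simp: nodes_def)
  have "square_integrable (param_measure E \<Otimes>\<^sub>M noise p)
      (\<lambda>z. coef_mat E (fst z) i j * sem_var E (fst z) i (snd z))" if i: "i \<in> {1..<j}" for i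
  proof (rule square_integrable_bound[OF IH[OF i]])
    have "(\<lambda>z. coef_mat E (fst z) i j) \<in> borel_measurable ((\<Pi>\<^sub>M e\<in>E. borel) \<Otimes>\<^sub>M noise p)"
      unfolding coef_mat_def by (cases "(i, j) \<in> E") simp_all
    then show "(\<lambda>z. coef_mat E (fst z) i j * sem_var E (fst z) i (snd z))
        \<in> borel_measurable (param_measure E \<Otimes>\<^sub>M noise p)"
      using IH[OF i] unfolding square_integrable_def
      by (intro borel_measurable_times measurable_param_pair[of "\<lambda>z. coef_mat E (fst z) i j"]) auto
  next
    fix z assume "z \<in> space (param_measure E \<Otimes>\<^sub>M noise p)"
    then have "fst z \<in> param_cube E" by (auto simp: space_pair_measure space_param_measure)
    then have "\<bar>coef_mat E (fst z) i j\<bar> \<le> 1"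
      unfolding coef_mat_def param_cube_def by (auto simp: PiE_iff abs_le_iff dest!: bspec)
    then show "\<bar>coef_mat E (fst z) i j * sem_var E (fst z) i (snd z)\<bar> \<le> \<bar>sem_var E (fst z) i (snd z)\<bar>"
      by (simp add: abs_mult mult_left_le_one_le)
  qed
  then show ?case
    unfolding sem_var.simps[of E _ j]
    by (intro square_integrable_add square_integrable_sum
        square_integrable_snd[OF finite_param_measure[OF E] prob_space_noise square_integrable_noise]) (use less in auto)
qed

section \<open>Measurability of the parameter sets\<close>

text \<open>The section lemma is applied to X_i, to X_j and to the product \<open>f\<close> of their
  residuals. The residuals in \<open>f\<close> are formed with the joint conditional expectations
  \<open>g\<close>, so that \<open>f\<close> is a single function on the product and its conditional
  expectation serves as \<open>h\<close>.\<close>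

lemma cond_cov_version:
  assumes E: "finite E" and S: "S \<subseteq> nodes p" and i: "i \<in> nodes p" and j: "j \<in> nodes p"
  obtains h where "h \<in> borel_measurable (param_measure E \<Otimes>\<^sub>M noise p)"
    "AE a in param_measure E. AE w in noise p. cond_cov p E a i j S w = h (a, w)"
proof -
  let ?Q = "param_measure E" and ?N = "noise p"
  let ?M = "\<Pi>\<^sub>M k\<in>S. (borel :: real measure)"
  let ?T = "\<lambda>z. \<lambda>k\<in>S. sem_var E (fst z) k (snd z)"
  let ?X = "\<lambda>k z. sem_var E (fst z) k (snd z)"
  interpret Q: finite_measure ?Q by (rule finite_param_measure[OF E])
  interpret N: prob_space ?N by (rule prob_space_noise)
  interpret R: finite_measure "?Q \<Otimes>\<^sub>M ?N" by (intro finite_measure_pair_measure) unfold_locales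
  have X: "square_integrable (?Q \<Otimes>\<^sub>M ?N) (?X k)" if "k \<in> nodes p" for k
    by (rule square_integrable_sem_var[OF E that])
  then have Xm: "?X k \<in> borel_measurable (?Q \<Otimes>\<^sub>M ?N)" if "k \<in> nodes p" for k
    using that by (auto simp: square_integrable_def)
  have T: "?T \<in> measurable (?Q \<Otimes>\<^sub>M ?N) ?M"
    by (rule measurable_restrict) (use Xm S in auto)
  have "countable S" using S finite_nodes by (meson countable_finite finite_subset)
  then obtain C where C: "countable C" "Int_stable C" "C \<subseteq> Pow (space ?M)" "space ?M \<in> C"
    "sets ?M = sigma_sets (space ?M) C"
    by (rule PiM_borel_countable_generator)
  define G where "G = vimage_algebra (space (?Q \<Otimes>\<^sub>M ?N)) (\<lambda>z. (fst z, ?T z)) (?Q \<Otimes>\<^sub>M ?M)"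
  have "(\<lambda>z. (fst z, ?T z)) \<in> measurable (?Q \<Otimes>\<^sub>M ?N) (?Q \<Otimes>\<^sub>M ?M)"
    using T by (intro measurable_Pair measurable_fst)
  then have "subalgebra (?Q \<Otimes>\<^sub>M ?N) G" unfolding G_def by (rule subalgebra_vimage_algebra)
  then interpret G: finite_measure_subalgebra "?Q \<Otimes>\<^sub>M ?N" G by unfold_locales
  have sec: "AE a in ?Q. AE w in ?N.
      real_cond_exp ?N (sem_sigma p E a S) (\<lambda>w. f (a, w)) w = real_cond_exp (?Q \<Otimes>\<^sub>M ?N) G f (a, w)"
    if "integrable (?Q \<Otimes>\<^sub>M ?N) f" for f
    using real_cond_exp_section[OF Q.finite_measure_axioms N.finite_measure_axioms C T that]
    by (simp add: sem_sigma_def G_def)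
  define g where "g k = real_cond_exp (?Q \<Otimes>\<^sub>M ?N) G (?X k)" for k
  have g: "square_integrable (?Q \<Otimes>\<^sub>M ?N) (g k)" if "k \<in> nodes p" for k
    unfolding g_def by (rule G.square_integrable_real_cond_exp[OF X[OF that]])
  define f where "f z = (?X i z - g i z) * (?X j z - g j z)" for z
  have f: "integrable (?Q \<Otimes>\<^sub>M ?N) f"
    unfolding f_def by (intro square_integrable_mult square_integrable_diff X g i j)
  have gi: "AE a in ?Q. AE w in ?N. real_cond_exp ?N (sem_sigma p E a S) (sem_var E a k) w = g k (a, w)"
    if "k \<in> nodes p" for k
    using sec[OF R.square_integrable_integrable[OF X[OF that]]] by (simp add: g_def)
  have "AE a in ?Q. AE w in ?N. cond_cov p E a i j S w = real_cond_exp (?Q \<Otimes>\<^sub>M ?N) G f (a, w)"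
    using gi[OF i] gi[OF j] sec[OF f] AE_space
  proof eventually_elim
    case (elim a)
    have sm: "(\<lambda>w. u (a, w)) \<in> borel_measurable ?N" if "u \<in> borel_measurable (?Q \<Otimes>\<^sub>M ?N)" for u :: "_ \<Rightarrow> real"
      using elim(4) that by measurable
    have Tm: "(\<lambda>w. ?T (a, w)) \<in> measurable ?N ?M"
      using measurable_compose[OF measurable_Pair1'[OF elim(4)] T] by simp
    have sub: "subalgebra ?N (sem_sigma p E a S)"
      unfolding sem_sigma_def using subalgebra_vimage_algebra[OF Tm] by simp
    then interpret F: finite_measure_subalgebra ?N "sem_sigma p E a S" by unfold_locales
    have xm: "sem_var E a k \<in> borel_measurable ?N" if "k \<in> nodes p" for k
      using sm[OF Xm[OF that]] by simp
    have rm: "real_cond_exp ?N (sem_sigma p E a S) u \<in> borel_measurable ?N" for u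
      by simp
    \<comment> \<open>For this \<open>a\<close>, the sections of \<open>g\<close> are versions of
      the inner conditional expectations, so the outer one is applied to almost surely equal
      integrands.\<close>
    have "AE w in ?N. cond_cov p E a i j S w = real_cond_exp ?N (sem_sigma p E a S) (\<lambda>w. f (a, w)) w"
      unfolding cond_cov_def
    proof (rule F.real_cond_exp_cong)
      show "AE w in ?N. (sem_var E a i w - real_cond_exp ?N (sem_sigma p E a S) (sem_var E a i) w) *
          (sem_var E a j w - real_cond_exp ?N (sem_sigma p E a S) (sem_var E a j) w) = f (a, w)"
        using elim(1,2) by eventually_elim (simp add: f_def)
      show "(\<lambda>w. f (a, w)) \<in> borel_measurable ?N" using f by (intro sm) auto
    qed (intro borel_measurable_times borel_measurable_diff xm i j rm)
    with elim(3) show ?case by eventually_elim simp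
  qed
  moreover have "real_cond_exp (?Q \<Otimes>\<^sub>M ?N) G f \<in> borel_measurable (?Q \<Otimes>\<^sub>M ?N)" by simp
  ultimately show thesis using that by blast
qed

text \<open>The property holds almost surely at \<open>a\<close> exactly when the section of the
  exceptional set has measure 0, and this measure is a measurable function of
  \<open>a\<close>.\<close>

lemma (in sigma_finite_measure) sets_Collect_AE_section:
  assumes P: "{z \<in> space (Q \<Otimes>\<^sub>M M). P z} \<in> sets (Q \<Otimes>\<^sub>M M)"
  shows "{a \<in> space Q. AE w in M. P (a, w)} \<in> sets Q"
proof -
  let ?B = "{z \<in> space (Q \<Otimes>\<^sub>M M). \<not> P z}"
  have B: "?B \<in> sets (Q \<Otimes>\<^sub>M M)" using P by (rule sets.sets_Collect_neg)
  have "(AE w in M. P (a, w)) \<longleftrightarrow> emeasure M (Pair a -` ?B) = 0" if "a \<in> space Q" for a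
  proof (rule AE_iff_measurable)
    show "Pair a -` ?B \<in> sets M" using B by (rule sets_Pair1)
    show "{w \<in> space M. \<not> P (a, w)} = Pair a -` ?B" using that by (auto simp: space_pair_measure)
  qed
  then have "{a \<in> space Q. AE w in M. P (a, w)} = {a \<in> space Q. emeasure M (Pair a -` ?B) = 0}" by auto
  also have "\<dots> \<in> sets Q" using measurable_emeasure_Pair[OF B] by measurable
  finally show ?thesis .
qed

text \<open>Replacing the three conditional covariances by their jointly measurable versions changes
  the set only on a null set of parameters, which the completion absorbs.\<close>

lemma P_set_measurable:
  assumes E: "finite E" and S: "S \<subseteq> nodes p" and i: "i \<in> nodes p" and j: "j \<in> nodes p"
  shows "P_set p E l i j S \<in> sets (completion (\<Pi>\<^sub>M e\<in>E. lborel))"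
proof -
  let ?Q = "param_measure E" and ?N = "noise p" and ?L = "\<Pi>\<^sub>M e\<in>E. (lborel :: real measure)"
  interpret N: prob_space ?N by (rule prob_space_noise)
  obtain h where h: "h \<in> borel_measurable (?Q \<Otimes>\<^sub>M ?N)"
    "AE a in ?Q. AE w in ?N. cond_cov p E a i j S w = h (a, w)"
    by (rule cond_cov_version[OF E S i j])
  obtain u where u: "u \<in> borel_measurable (?Q \<Otimes>\<^sub>M ?N)"
    "AE a in ?Q. AE w in ?N. cond_cov p E a i i S w = u (a, w)"
    by (rule cond_cov_version[OF E S i i])
  obtain v where v: "v \<in> borel_measurable (?Q \<Otimes>\<^sub>M ?N)"
    "AE a in ?Q. AE w in ?N. cond_cov p E a j j S w = v (a, w)"
    by (rule cond_cov_version[OF E S j j])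
  let ?B = "{a \<in> space ?Q. AE w in ?N. \<bar>h (a, w)\<bar> \<le> l * sqrt (u (a, w) * v (a, w))}"
  have cube: "param_cube E \<in> sets ?L" by (rule param_cube_sets[OF E])
  then have cube': "param_cube E \<inter> space ?L \<in> sets ?L" by auto
  have "?B \<in> sets ?Q"
    by (rule N.sets_Collect_AE_section) (use h(1) u(1) v(1) in measurable)
  then have B: "?B \<in> sets ?L"
    unfolding param_measure_def using cube' by (simp add: sets_restrict_space_iff)
  have "AE a in ?Q. a \<in> P_set p E l i j S \<longleftrightarrow> a \<in> ?B"
    using h(2) u(2) v(2) AE_space
  proof eventually_elim
    case (elim a)
    have "(AE w in ?N. \<bar>cond_cov p E a i j S w\<bar> \<le> l * sqrt (cond_cov p E a i i S w * cond_cov p E a j j S w))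
      \<longleftrightarrow> (AE w in ?N. \<bar>h (a, w)\<bar> \<le> l * sqrt (u (a, w) * v (a, w)))"
    proof
      assume "AE w in ?N. \<bar>cond_cov p E a i j S w\<bar> \<le> l * sqrt (cond_cov p E a i i S w * cond_cov p E a j j S w)"
      with elim(1-3) show "AE w in ?N. \<bar>h (a, w)\<bar> \<le> l * sqrt (u (a, w) * v (a, w))"
        by eventually_elim simp
    next
      assume "AE w in ?N. \<bar>h (a, w)\<bar> \<le> l * sqrt (u (a, w) * v (a, w))"
      with elim(1-3) show "AE w in ?N. \<bar>cond_cov p E a i j S w\<bar> \<le> l * sqrt (cond_cov p E a i i S w * cond_cov p E a j j S w)"
        by eventually_elim simp
    qed
    then show ?case using elim(4) by (simp add: P_set_def cond_var_def space_param_measure)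
  qed
  moreover have "(AE a in ?Q. R a) \<longleftrightarrow> (AE a in ?L. a \<in> param_cube E \<longrightarrow> R a)" for R
    unfolding param_measure_def by (rule AE_restrict_space_iff[OF cube'])
  ultimately have "AE a in ?L. a \<in> param_cube E \<longrightarrow> (a \<in> P_set p E l i j S \<longleftrightarrow> a \<in> ?B)"
    by (simp only:)
  \<comment> \<open>Outside the cube neither set has a point, so the equivalence holds almost
    everywhere.\<close>
  then have ae: "AE a in completion ?L. a \<in> ?B \<longleftrightarrow> a \<in> P_set p E l i j S"
    by (intro AE_completion, elim eventually_mono) (auto simp: P_set_def space_param_measure)
  have "P_set p E l i j S \<subseteq> space ?L"
    using sets.sets_into_space[OF cube] by (auto simp: P_set_def)
  then show ?thesis
    using completion.in_sets_AE[OF ae] B by simp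
qed

section \<open>Rooted trees\<close>

lemma rooted_tree_edges:
  assumes "rooted_tree p E"
  shows "finite E" and "(i, j) \<in> E \<Longrightarrow> i \<in> nodes p \<and> j \<in> nodes p \<and> i < j"
proof -
  have d: "E \<subseteq> nodes p \<times> nodes p" "\<forall>(i, j)\<in>E. i < j"
    using assms by (auto simp: rooted_tree_def dag_def)
  then show "finite E" by (auto intro: finite_subset simp: nodes_def)
  show "(i, j) \<in> E \<Longrightarrow> i \<in> nodes p \<and> j \<in> nodes p \<and> i < j" using d by auto
qed

lemma skel_path_snoc:
  assumes "skel_path E r (ys @ [x]) x" "adjacent E x j" "j \<notin> set (ys @ [x])"
  shows "skel_path E r (ys @ [x, j]) j"
  using assms unfolding skel_path_def
  by (auto simp: successively_append_iff hd_append)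

lemma skel_path_prefix:
  assumes "skel_path E r (ys @ x # zs) j"
  shows "skel_path E r (ys @ [x]) x"
  using assms unfolding skel_path_def
  by (auto simp: successively_append_iff hd_append)

text \<open>A path from the root to \<open>j\<close> meets both parents. Cutting it after the first
  one met and stepping directly to \<open>j\<close> gives a path that misses the other, against the
  orientation away from the root.\<close>

lemma rooted_tree_parent_unique:
  assumes T: "rooted_tree p E" and "(i, j) \<in> E" "(k, j) \<in> E"
  shows "i = k"
proof (rule ccontr)
  assume "i \<noteq> k"
  from T obtain r where r: "r \<in> nodes p" "\<And>i j xs. (i, j) \<in> E \<Longrightarrow> skel_path E r xs j \<Longrightarrow> i \<in> set xs"
    unfolding rooted_tree_def by blast
  have "j \<in> nodes p" using rooted_tree_edges(2)[OF T assms(2)] by simp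
  then obtain xs where xs: "skel_path E r xs j" using T r(1) unfolding rooted_tree_def by blast
  \<comment> \<open>The local \<open>i\<close> and \<open>k\<close> are generalised, so that both
    orders of the parents along the path are covered.\<close>
  have aux: False
    if ij: "(i, j) \<in> E" "(k, j) \<in> E" and xs: "skel_path E r (ys @ i # zs) j" and k: "k \<in> set zs" for i k ys zs
  proof -
    have d: "distinct (ys @ i # zs)" "last (ys @ i # zs) = j" using xs by (auto simp: skel_path_def)
    have "zs \<noteq> []" using k by auto
    then have "j \<in> set zs" using d(2) by (metis last_appendR last_ConsR last_in_set list.distinct(1))
    then have "j \<notin> set (ys @ [i])" using d(1) by auto
    then have "skel_path E r (ys @ [i, j]) j"
      using ij by (intro skel_path_snoc[OF skel_path_prefix[OF xs]]) (auto simp: adjacent_def)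
    from r(2)[OF ij(2) this] have "k \<in> set (ys @ [i, j])" .
    moreover have "k \<noteq> j" using rooted_tree_edges(2)[OF T ij(2)] by simp
    ultimately show False using d(1) k by auto
  qed
  have "i \<in> set xs" using r(2) assms(2) xs by blast
  then obtain ys zs where yz: "xs = ys @ i # zs" by (meson split_list)
  have "k \<in> set xs" using r(2) assms(3) xs by blast
  with yz \<open>i \<noteq> k\<close> consider "k \<in> set zs" | "k \<in> set ys" by auto
  then show False
  proof cases
    case 1 then show False using aux[OF assms(2,3)] xs yz by blast
  next
    case 2
    then obtain us vs where "ys = us @ k # vs" by (meson split_list)
    with yz have "xs = us @ k # (vs @ i # zs)" by simp
    then show False using aux[OF assms(3,2)] xs by (metis in_set_conv_decomp)
  qed
qed

text \<open>Every node but the root is the head of an edge, namely of the last one on a path from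
  the root. A lower bound is what the theorem calls for, since \<open>(1 - l) ^ n\<close> decreases
  in \<open>n\<close>.\<close>

lemma rooted_tree_card_edges:
  assumes T: "rooted_tree p E"
  shows "p - 1 \<le> card E"
proof -
  from T obtain r where r: "r \<in> nodes p" "\<And>i j xs. (i, j) \<in> E \<Longrightarrow> skel_path E r xs j \<Longrightarrow> i \<in> set xs"
    unfolding rooted_tree_def by blast
  have "nodes p - {r} \<subseteq> snd ` E"
  proof
    fix j assume j: "j \<in> nodes p - {r}"
    then obtain xs where xs: "skel_path E r xs j" using T r(1) unfolding rooted_tree_def by blast
    then obtain ys where "xs = ys @ [j]" unfolding skel_path_def by (metis append_butlast_last_id)
    moreover have "ys \<noteq> []" using xs calculation j by (auto simp: skel_path_def)
    then obtain zs x where "ys = zs @ [x]" by (metis rev_exhaust)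
    ultimately have xs': "xs = zs @ x # [j]" by simp
    have pre: "skel_path E r (zs @ [x]) x" using xs unfolding xs' by (rule skel_path_prefix)
    have "adjacent E x j" "j \<notin> set (zs @ [x])"
      using xs unfolding xs' by (auto simp: skel_path_def successively_append_iff)
    \<comment> \<open>Were the edge directed from \<open>j\<close> to \<open>x\<close>, the path
      ending in \<open>x\<close> would have to contain \<open>j\<close>.\<close>
    then have "(x, j) \<in> E" using r(2)[OF _ pre, of j] by (auto simp: adjacent_def)
    then show "j \<in> snd ` E" by force
  qed
  then have "card (nodes p - {r}) \<le> card (snd ` E)"
    using rooted_tree_edges(1)[OF T] by (intro card_mono) auto
  also have "\<dots> \<le> card E" using rooted_tree_edges(1)[OF T] by (rule card_image_le)
  finally show ?thesis using r(1) by (simp add: nodes_def)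
qed

text \<open>The path \<open>[i, j]\<close> has no interior node that could block it.\<close>

lemma adjacent_not_d_separated:
  assumes "adjacent E i j" "i \<noteq> j"
  shows "\<not> d_separated E i j S"
proof
  assume d: "d_separated E i j S"
  have "skel_path E i [i, j] j" using assms by (simp add: skel_path_def)
  with d show False unfolding d_separated_def by force
qed

lemma card_parents_le_max_degree:
  assumes "finite E" "i \<in> nodes p"
  shows "card {u. (u, i) \<in> E} \<le> max_degree p E"
proof -
  have "card {u. (u, i) \<in> E} + card {w. (i, w) \<in> E} \<le> max_degree p E"
    unfolding max_degree_def using assms(2) by (intro Max_ge) (auto simp: nodes_def)
  then show ?thesis by simp
qed

section \<open>The partial correlation along an edge\<close>

text \<open>Makes variables before a node functions of the noise before that node. At index 0 the
  recursion would read \<open>w 0\<close>, which lies outside \<open>{1..0}\<close>.\<close>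

lemma sem_var_cong:
  assumes "1 \<le> j" "\<And>k. k \<in> {1..j} \<Longrightarrow> w k = w' k"
  shows "sem_var E a j w = sem_var E a j w'"
  using assms
proof (induction j rule: less_induct)
  case (less j)
  have "sem_var E a i w = sem_var E a i w'" if "i \<in> {1..<j}" for i
    using that by (intro less.IH less.prems) auto
  then show ?case using less.prems by (simp add: sem_var.simps[of E a j])
qed

section \<open>Measurability and integrability for a fixed parameter\<close>

lemma measurable_sem_var_section:
  assumes "a \<in> param_cube E" "j \<in> nodes p"
  shows "sem_var E a j \<in> borel_measurable (noise p)"
proof -
  have a: "a \<in> space (\<Pi>\<^sub>M e\<in>E. (borel :: real measure))"
    using assms(1) by (auto simp: param_cube_def space_PiM PiE_iff)
  show ?thesis
    using measurable_compose[OF measurable_Pair1'[OF a] measurable_sem_var[OF assms(2)]] by simp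
qed

lemma square_integrable_cmult:
  "square_integrable M f \<Longrightarrow> square_integrable M (\<lambda>x. c * f x)"
  by (auto simp: square_integrable_def power_mult_distrib)

text \<open>For fixed \<open>a\<close> the coefficients are constants, so closure under scaling
  takes the place of the bound on the cube.\<close>

lemma square_integrable_sem_var_section:
  assumes "j \<in> nodes p"
  shows "square_integrable (noise p) (sem_var E a j)"
  using assms
proof (induction j rule: less_induct)
  case (less j)
  have "square_integrable (noise p) (\<lambda>w. (\<Sum>i\<in>{1..<j}. coef_mat E a i j * sem_var E a i w) + w j)"
    using less.prems
    by (intro square_integrable_add square_integrable_sum square_integrable_cmult
        less.IH square_integrable_noise) (auto simp: nodes_def)
  then show ?case by (simp add: sem_var.simps[of E a j, abs_def])
qed

lemma subalgebra_sem_sigma: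
  assumes "a \<in> param_cube E" "S \<subseteq> nodes p"
  shows "subalgebra (noise p) (sem_sigma p E a S)"
  unfolding sem_sigma_def
  by (intro subalgebra_vimage_algebra measurable_restrict measurable_sem_var_section) (use assms in auto)

lemma sem_var_measurable_sem_sigma:
  assumes "k \<in> S"
  shows "sem_var E a k \<in> borel_measurable (sem_sigma p E a S)"
proof -
  have "(\<lambda>w. \<lambda>k\<in>S. sem_var E a k w) \<in> measurable (sem_sigma p E a S) (\<Pi>\<^sub>M k\<in>S. borel)"
    unfolding sem_sigma_def by (rule measurable_vimage_algebra1) (auto simp: space_PiM)
  from measurable_compose[OF this measurable_component_singleton[OF assms]] assms show ?thesis by simp
qed

section \<open>Independence of earlier and later noise\<close>

lemma indep_var_noise_blocks:
  assumes "A \<union> B \<subseteq> nodes p" "A \<inter> B = {}" "A \<noteq> {} \<or> B \<noteq> {}"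
    and f: "f \<in> borel_measurable (\<Pi>\<^sub>M k\<in>A. borel)" and g: "g \<in> borel_measurable (\<Pi>\<^sub>M k\<in>B. borel)"
  shows "prob_space.indep_var (noise p) borel (\<lambda>w. f (restrict w A) :: real) borel (\<lambda>w. g (restrict w B) :: real)"
proof -
  interpret prob_space "noise p" by (rule prob_space_noise)
  have "nodes p \<noteq> {}" using assms(1,3) by auto
  from indep_vars_noise[OF this] have
    "indep_var (\<Pi>\<^sub>M k\<in>A. borel) (\<lambda>w. restrict w A) (\<Pi>\<^sub>M k\<in>B. borel) (\<lambda>w. restrict w B)"
    using indep_var_restrict[where M'="\<lambda>_. borel" and X="\<lambda>j w. w j" and I="nodes p" and A=A and B=B] assms(1,2)
    by simp
  from indep_var_compose[OF this f g] show ?thesis by (simp add: comp_def)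
qed

lemma noise_covariance:
  assumes "i \<in> nodes p" "j \<in> nodes p" "i \<noteq> j"
  shows "(\<integral>w. w i * w j \<partial>noise p) = 0"
proof -
  interpret prob_space "noise p" by (rule prob_space_noise)
  have "indep_var borel (\<lambda>w. restrict w {i} i) borel (\<lambda>w. restrict w {j} j)"
    by (rule indep_var_noise_blocks) (use assms in auto)
  then have "indep_var borel (\<lambda>w. w i) borel (\<lambda>w. w j)" by simp
  from indep_var_lebesgue_integral[OF this] show ?thesis
    using noise_moment[OF assms(1)] noise_moment[OF assms(2)] noise_moment(1)[OF assms(1), of 1]
      noise_moment(1)[OF assms(2), of 1] by simp
qed

text \<open>X_S is a function of the noise before \<open>i\<close>, hence independent of the noise
  from \<open>i\<close> on; conditioning on it returns the mean.\<close>

lemma real_cond_exp_later_noise: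
  assumes a: "a \<in> param_cube E" and i: "i \<in> nodes p" and S: "S \<subseteq> {1..<i}"
    and f: "f \<in> borel_measurable (\<Pi>\<^sub>M k\<in>{i..p}. borel)"
    and int: "integrable (noise p) (\<lambda>w. f (restrict w {i..p}))"
  shows "AE w in noise p. real_cond_exp (noise p) (sem_sigma p E a S) (\<lambda>w. f (restrict w {i..p})) w =
           (\<integral>w. f (restrict w {i..p}) \<partial>noise p)"
proof -
  let ?N = "noise p" and ?F = "sem_sigma p E a S" and ?A = "{1..<i}" and ?B = "{i..p}"
  let ?M = "\<Pi>\<^sub>M k\<in>S. (borel :: real measure)"
  let ?T = "\<lambda>w. \<lambda>k\<in>S. sem_var E a k w"
  interpret prob_space ?N by (rule prob_space_noise)
  have Sn: "S \<subseteq> nodes p" using S i by (auto simp: nodes_def)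
  have "subalgebra ?N ?F" by (rule subalgebra_sem_sigma[OF a Sn])
  then interpret F: finite_measure_subalgebra ?N ?F by unfold_locales
  have nodes_i: "nodes (i - 1) = ?A" using i by (auto simp: nodes_def)
  have T: "?T \<in> measurable (\<Pi>\<^sub>M k\<in>?A. borel) ?M"
  proof -
    \<comment> \<open>The nodes before \<open>i\<close> form a smaller model whose noise space is
      the block \<open>?A\<close>; measurability there makes \<open>?T\<close> a measurable function
      of that block.\<close>
    have "?T \<in> measurable (noise (i - 1)) ?M"
      by (intro measurable_restrict measurable_sem_var_section a) (use S nodes_i in auto)
    moreover have "sets (noise (i - 1)) = sets (\<Pi>\<^sub>M k\<in>?A. borel)"
      using sets_noise[of "i - 1"] by (simp only: nodes_i)
    ultimately show ?thesis
      using measurable_cong_sets[OF _ refl] by blast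
  qed
  have T_restrict: "?T (restrict w ?A) = ?T w" for w
    using S by (intro restrict_ext sem_var_cong) auto
  show ?thesis
  proof (rule F.real_cond_exp_charact)
    fix D assume "D \<in> sets ?F"
    then obtain C where C: "C \<in> sets ?M" and D: "D = ?T -` C \<inter> space ?N"
      unfolding sem_sigma_def by (subst (asm) sets_vimage_algebra2) (auto simp: space_PiM)
    have DN: "D \<in> sets ?N" using \<open>D \<in> sets ?F\<close> F.subalg by (auto simp: subalgebra_def)
    let ?g = "\<lambda>w. indicator C (?T w) :: real"
    have g: "?g \<in> borel_measurable (\<Pi>\<^sub>M k\<in>?A. borel)"
      using measurable_compose[OF T borel_measurable_indicator[OF C]] .
    have "indep_var borel (\<lambda>w. ?g (restrict w ?A)) borel (\<lambda>w. f (restrict w ?B))"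
      by (rule indep_var_noise_blocks[OF _ _ _ g f]) (use i in \<open>auto simp: nodes_def\<close>)
    then have ind: "indep_var borel ?g borel (\<lambda>w. f (restrict w ?B))"
      by (simp only: T_restrict)
    have gD: "?g w = indicator D w" if "w \<in> space ?N" for w
      using that by (simp add: D indicator_def)
    have gint: "integrable ?N ?g"
      using DN gD by (subst Bochner_Integration.integrable_cong[OF refl gD]) (auto simp: emeasure_eq_measure)
    have "(LINT w:D|?N. f (restrict w ?B)) = (\<integral>w. ?g w * f (restrict w ?B) \<partial>?N)"
      unfolding set_lebesgue_integral_def by (intro Bochner_Integration.integral_cong) (simp_all add: gD)
    also have "\<dots> = (\<integral>w. ?g w \<partial>?N) * (\<integral>w. f (restrict w ?B) \<partial>?N)"
      by (rule indep_var_lebesgue_integral[OF ind gint int])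
    also have "\<dots> = (\<integral>w. ?g w * (\<integral>w. f (restrict w ?B) \<partial>?N) \<partial>?N)" by simp
    also have "\<dots> = (LINT w:D|?N. (\<integral>w. f (restrict w ?B) \<partial>?N))"
      unfolding set_lebesgue_integral_def by (intro Bochner_Integration.integral_cong) (simp_all add: gD)
    finally show "(LINT w:D|?N. f (restrict w ?B)) = (LINT w:D|?N. (\<integral>w. f (restrict w ?B) \<partial>?N))" .
  qed (use int in auto)
qed

text \<open>If \<open>X\<^sub>k = Y + U\<close> and \<open>X\<^sub>m = Z + V\<close>, where \<open>Y\<close> and \<open>Z\<close> are functions of \<open>X\<^sub>S\<close> while \<open>U\<close> and
  \<open>V\<close> are centred functions of noise independent of \<open>X\<^sub>S\<close>, then \<open>U\<close> and \<open>V\<close> are the residuals.\<close>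

lemma cond_cov_eq_residual_covariance:
  fixes U V :: "(nat \<Rightarrow> real) \<Rightarrow> real"
  assumes a: "a \<in> param_cube E" and i: "i \<in> nodes p" and S: "S \<subseteq> {1..<i}"
    and X: "\<And>w. sem_var E a k w = Y w + U w" "\<And>w. sem_var E a m w = Z w + V w"
    and km: "k \<in> nodes p" "m \<in> nodes p"
    and YZ: "Y \<in> borel_measurable (sem_sigma p E a S)" "Z \<in> borel_measurable (sem_sigma p E a S)"
    and UV: "U \<in> borel_measurable (\<Pi>\<^sub>M k\<in>{i..p}. borel)" "V \<in> borel_measurable (\<Pi>\<^sub>M k\<in>{i..p}. borel)"
    and restr: "\<And>w. U (restrict w {i..p}) = U w" "\<And>w. V (restrict w {i..p}) = V w"
    and sq: "square_integrable (noise p) U" "square_integrable (noise p) V"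
    and cent: "(\<integral>w. U w \<partial>noise p) = 0" "(\<integral>w. V w \<partial>noise p) = 0"
  shows "AE w in noise p. cond_cov p E a k m S w = (\<integral>w. U w * V w \<partial>noise p)"
proof -
  let ?N = "noise p" and ?F = "sem_sigma p E a S"
  interpret prob_space ?N by (rule prob_space_noise)
  have Sn: "S \<subseteq> nodes p" using S i by (auto simp: nodes_def)
  have "subalgebra ?N ?F" by (rule subalgebra_sem_sigma[OF a Sn])
  then interpret F: finite_measure_subalgebra ?N ?F by unfold_locales
  have proj: "AE w in ?N. sem_var E a k w - real_cond_exp ?N ?F (sem_var E a k) w = U w"
    if X: "\<And>w. sem_var E a k w = Y w + U w" and k: "k \<in> nodes p"
      and Y: "Y \<in> borel_measurable ?F" and U: "U \<in> borel_measurable (\<Pi>\<^sub>M k\<in>{i..p}. borel)"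
      and r: "\<And>w. U (restrict w {i..p}) = U w" and sq: "square_integrable ?N U" and c: "(\<integral>w. U w \<partial>?N) = 0"
    for k Y U
  proof -
    have Ui: "integrable ?N U" by (rule square_integrable_integrable[OF sq])
    \<comment> \<open>\<open>Y\<close> is assumed measurable only; its integrability comes from
      writing it as this difference.\<close>
    have "integrable ?N (\<lambda>w. sem_var E a k w - U w)"
      using square_integrable_integrable[OF square_integrable_sem_var_section[OF k]] Ui by auto
    then have Yi: "integrable ?N Y" by (simp add: X)
    have "AE w in ?N. real_cond_exp ?N ?F U w = 0"
      using real_cond_exp_later_noise[OF a i S U] Ui by (simp add: r c)
    moreover have "AE w in ?N. real_cond_exp ?N ?F Y w = Y w" using Yi Y by (rule F.real_cond_exp_F_meas)
    moreover have "AE w in ?N. real_cond_exp ?N ?F (\<lambda>w. Y w + U w) w = real_cond_exp ?N ?F Y w + real_cond_exp ?N ?F U w"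
      using Yi Ui by (rule F.real_cond_exp_add)
    moreover have "sem_var E a k = (\<lambda>w. Y w + U w)" using X by auto
    ultimately show ?thesis by auto
  qed
  have m: "sem_var E a k \<in> borel_measurable ?N" if "k \<in> nodes p" for k
    using measurable_sem_var_section[OF a that] .
  have rm: "real_cond_exp ?N ?F u \<in> borel_measurable ?N" for u by simp
  have UVi: "integrable ?N (\<lambda>w. U w * V w)" by (rule square_integrable_mult[OF sq])
  have "AE w in ?N. cond_cov p E a k m S w = real_cond_exp ?N ?F (\<lambda>w. U w * V w) w"
    unfolding cond_cov_def
  proof (rule F.real_cond_exp_cong)
    show "AE w in ?N. (sem_var E a k w - real_cond_exp ?N ?F (sem_var E a k) w) *
        (sem_var E a m w - real_cond_exp ?N ?F (sem_var E a m) w) = U w * V w"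
      using proj[OF X(1) km(1) YZ(1) UV(1) restr(1) sq(1) cent(1)]
        proj[OF X(2) km(2) YZ(2) UV(2) restr(2) sq(2) cent(2)]
      by eventually_elim simp
    show "(\<lambda>w. U w * V w) \<in> borel_measurable ?N" using UVi by auto
  qed (intro borel_measurable_times borel_measurable_diff m km rm)
  \<comment> \<open>The product of the residuals is again a function of the noise from
    \<open>i\<close> on.\<close>
  moreover have "AE w in ?N. real_cond_exp ?N ?F (\<lambda>w. U w * V w) w = (\<integral>w. U w * V w \<partial>?N)"
    using real_cond_exp_later_noise[OF a i S borel_measurable_times[OF UV]] UVi by (simp add: restr)
  ultimately show ?thesis by eventually_elim simp
qed

text \<open>With \<open>Y\<close> the part of X_i explained by its parents and c =
  \<open>a (i, j)\<close>, uniqueness of the parent of \<open>j\<close> gives X_j = c Y + (c eps_i +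
  eps_j). The residuals then have covariance c and variances 1 and c^2 + 1.\<close>

lemma small_coefficient_in_P_set:
  assumes T: "rooted_tree p E" and e: "(i, j) \<in> E" and a: "a \<in> param_cube E"
    and l: "0 < l" and al: "\<bar>a (i, j)\<bar> \<le> l"
  shows "a \<in> P_set p E l i j {u. (u, i) \<in> E}"
proof -
  let ?S = "{u. (u, i) \<in> E}" and ?N = "noise p" and ?c = "a (i, j)"
  let ?F = "sem_sigma p E a ?S"
  interpret prob_space ?N by (rule prob_space_noise)
  have ij: "i \<in> nodes p" "j \<in> nodes p" "i < j" using rooted_tree_edges(2)[OF T e] by auto
  \<comment> \<open>Edges increase the labels, so the parents of \<open>i\<close> precede
    \<open>i\<close>, as independence from the noise from \<open>i\<close> on requires.\<close>
  have S: "?S \<subseteq> {1..<i}" using rooted_tree_edges(2)[OF T] by (auto simp: nodes_def)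
  define Y where "Y w = (\<Sum>u\<in>{1..<i}. coef_mat E a u i * sem_var E a u w)" for w
  have Y: "Y \<in> borel_measurable ?F"
    unfolding Y_def
  proof (intro borel_measurable_sum)
    fix u
    show "(\<lambda>w. coef_mat E a u i * sem_var E a u w) \<in> borel_measurable ?F"
    \<comment> \<open>Summands of nonparents vanish, so \<open>Y\<close> depends on X_S
      only.\<close>
    proof (cases "(u, i) \<in> E")
      case True
      then show ?thesis by (intro borel_measurable_times sem_var_measurable_sem_sigma) auto
    qed (simp add: coef_mat_def)
  qed
  have Xi: "sem_var E a i w = Y w + w i" for w
    unfolding Y_def by (rule sem_var.simps)
  have Xj: "sem_var E a j w = ?c * Y w + (?c * w i + w j)" for w
  proof -
    have "(\<Sum>u\<in>{1..<j}. coef_mat E a u j * sem_var E a u w) = (\<Sum>u\<in>{i}. coef_mat E a u j * sem_var E a u w)"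
      using ij rooted_tree_parent_unique[OF T _ e]
      by (intro sum.mono_neutral_right) (auto simp: nodes_def coef_mat_def)
    then show ?thesis
      using e by (simp add: sem_var.simps[of E a j] coef_mat_def Xi algebra_simps)
  qed
  let ?V = "\<lambda>w. ?c * w i + w j"
  have Wm: "(\<lambda>w. w i) \<in> borel_measurable (\<Pi>\<^sub>M k\<in>{i..p}. (borel :: real measure))"
    "(\<lambda>w. w j) \<in> borel_measurable (\<Pi>\<^sub>M k\<in>{i..p}. (borel :: real measure))"
    using ij by (auto simp: nodes_def)
  have Vm: "?V \<in> borel_measurable (\<Pi>\<^sub>M k\<in>{i..p}. (borel :: real measure))"
    using Wm by (intro borel_measurable_add borel_measurable_times) auto
  have r: "restrict w {i..p} i = w i" "restrict w {i..p} j = w j" for w :: "nat \<Rightarrow> real"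
    using ij by (auto simp: nodes_def)
  have sq: "square_integrable ?N (\<lambda>w. w i)" "square_integrable ?N (\<lambda>w. w j)" "square_integrable ?N ?V"
    using ij by (intro square_integrable_noise square_integrable_add square_integrable_cmult; simp)+
  have int: "integrable ?N (\<lambda>w. w i)" "integrable ?N (\<lambda>w. w j)"
    using sq by (auto intro: square_integrable_integrable)
  have int2: "integrable ?N (\<lambda>w. (w i)\<^sup>2)" "integrable ?N (\<lambda>w. (w j)\<^sup>2)" "integrable ?N (\<lambda>w. w i * w j)"
    using sq square_integrable_mult[OF sq(1,2)] by (auto simp: square_integrable_def)
  note moments = noise_moment(2,3)[OF ij(1)] noise_moment(2,3)[OF ij(2)] noise_covariance[OF ij(1,2)]
  have centV: "(\<integral>w. ?V w \<partial>?N) = 0" using int by (simp add: moments)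
  have UV: "(\<integral>w. w i * ?V w \<partial>?N) = ?c"
  proof -
    have "(\<lambda>w. w i * ?V w) = (\<lambda>w. ?c * (w i)\<^sup>2 + w i * w j)" by (auto simp: power2_eq_square algebra_simps)
    then show ?thesis using int2 ij by (simp add: moments)
  qed
  have VV: "(\<integral>w. ?V w * ?V w \<partial>?N) = ?c\<^sup>2 + 1"
  proof -
    have "(\<lambda>w. ?V w * ?V w) = (\<lambda>w. ?c\<^sup>2 * (w i)\<^sup>2 + (2 * ?c * (w i * w j) + (w j)\<^sup>2))"
      by (auto simp: power2_eq_square algebra_simps)
    then show ?thesis using int2 ij by (simp add: moments)
  qed
  have UU: "(\<integral>w. w i * w i \<partial>?N) = 1" using moments(2) by (simp add: power2_eq_square)
  have cY: "(\<lambda>w. ?c * Y w) \<in> borel_measurable ?F" using Y by auto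
  note res = cond_cov_eq_residual_covariance[OF a ij(1) S]
  have rV: "?c * restrict w {i..p} i + restrict w {i..p} j = ?V w" for w :: "nat \<Rightarrow> real"
    by (simp only: r)
  have cov: "AE w in ?N. cond_cov p E a i j ?S w = ?c"
    using res[OF Xi Xj ij(1,2) Y cY Wm(1) Vm r(1) rV sq(1,3) moments(1) centV] by (simp only: UV)
  have var_i: "AE w in ?N. cond_cov p E a i i ?S w = 1"
    using res[OF Xi Xi ij(1,1) Y Y Wm(1,1) r(1) r(1) sq(1,1) moments(1,1)] by (simp only: UU)
  have var_j: "AE w in ?N. cond_cov p E a j j ?S w = ?c\<^sup>2 + 1"
    using res[OF Xj Xj ij(2,2) cY cY Vm Vm rV rV sq(3,3) centV centV] by (simp only: VV)
  have bound: "\<bar>?c\<bar> \<le> l * sqrt (1 * (?c\<^sup>2 + 1))"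
  proof -
    \<comment> \<open>The square root is at least 1, so a coefficient of absolute value at most
      \<open>l\<close> satisfies the bound.\<close>
    have "l * 1 \<le> l * sqrt (1 * (?c\<^sup>2 + 1))" using l by (intro mult_left_mono) auto
    then show ?thesis using al by linarith
  qed
  have "AE w in ?N. \<bar>cond_cov p E a i j ?S w\<bar> \<le> l * sqrt (cond_var p E a i ?S w * cond_var p E a j ?S w)"
    unfolding cond_var_def using cov var_i var_j by eventually_elim (use bound in simp)
  then show ?thesis using a by (simp add: P_set_def)
qed

section \<open>Volumes\<close>

text \<open>By \<open>cover\<close>, the union contains the cube minus \<open>?B\<close>.
  Monotonicity of \<open>measure\<close> needs the larger set to be measurable of finite measure: it
  is a finite union of measurable sets inside the cube.\<close>

lemma vol_Union_lower_bound:
  fixes F :: "(nat \<times> nat \<Rightarrow> real) set set"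
  assumes E: "finite E" and l: "0 < l" "l < 1"
    and F: "finite F" "\<And>P. P \<in> F \<Longrightarrow> P \<in> sets (completion (\<Pi>\<^sub>M e\<in>E. lborel))"
      "\<And>P. P \<in> F \<Longrightarrow> P \<subseteq> param_cube E"
    and cover: "\<And>a e. a \<in> param_cube E \<Longrightarrow> e \<in> E \<Longrightarrow> \<bar>a e\<bar> \<le> l \<Longrightarrow> a \<in> \<Union>F"
  shows "1 - (1 - l) ^ card E \<le> vol E (\<Union>F) / 2 ^ card E"
proof -
  let ?L = "\<Pi>\<^sub>M e\<in>E. (lborel :: real measure)"
  \<comment> \<open>\<open>?B\<close> consists of the parameters all of whose entries exceed
    \<open>l\<close> in absolute value.\<close>
  let ?A = "{-1..1} - {-l..l} :: real set"
  let ?B = "\<Pi>\<^sub>E e\<in>E. ?A"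
  interpret finite_product_sigma_finite "\<lambda>_. lborel :: real measure" E
    by unfold_locales (rule E)
  have cube: "param_cube E \<in> sets ?L" by (rule param_cube_sets[OF E])
  have B: "?B \<in> sets ?L" using E by (intro sets_PiM_I_finite) auto
  have ecube: "emeasure ?L (param_cube E) = ennreal (2 ^ card E)"
  proof -
    have "emeasure ?L (param_cube E) = (\<Prod>e\<in>E. emeasure lborel {-1..1::real})"
      unfolding param_cube_def by (rule measure_times) auto
    also have "\<dots> = (\<Prod>e\<in>E. ennreal 2)" by simp
    also have "\<dots> = ennreal (2 ^ card E)"
      unfolding prod_constant by (rule ennreal_power) simp
    finally show ?thesis .
  qed
  have eA: "emeasure lborel ?A = ennreal (2 * (1 - l))"
  proof -
    have "emeasure lborel ?A = emeasure lborel {-1..1::real} - emeasure lborel {-l..l}"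
      using l by (intro emeasure_Diff) auto
    also have "\<dots> = ennreal 2 - ennreal (2 * l)" using l by simp
    also have "\<dots> = ennreal (2 * (1 - l))" using l by (subst ennreal_minus) (simp_all add: algebra_simps)
    finally show ?thesis .
  qed
  have eB: "emeasure ?L ?B = ennreal ((2 * (1 - l)) ^ card E)"
  proof -
    have "emeasure ?L ?B = (\<Prod>e\<in>E. emeasure lborel ?A)" by (rule measure_times) auto
    also have "\<dots> = ennreal ((2 * (1 - l)) ^ card E)" using l by (simp add: eA ennreal_power)
    finally show ?thesis .
  qed
  have mcube: "measure ?L (param_cube E) = 2 ^ card E" using ecube by (simp add: measure_def)
  have mB: "measure ?L ?B = (2 * (1 - l)) ^ card E" using eB l by (simp add: measure_def)
  have BC: "?B \<subseteq> param_cube E" unfolding param_cube_def by (rule PiE_mono) auto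
  have "2 ^ card E - (2 * (1 - l)) ^ card E = measure ?L (param_cube E - ?B)"
    using measure_Diff[OF _ cube B BC] ecube by (simp add: mcube mB)
  also have "\<dots> = measure (completion ?L) (param_cube E - ?B)"
    using cube B by simp
  also have "\<dots> \<le> measure (completion ?L) (\<Union>F)"
  proof (rule measure_mono_fmeasurable)
    show "param_cube E - ?B \<subseteq> \<Union>F"
    proof
      fix a assume a: "a \<in> param_cube E - ?B"
      then obtain e where "e \<in> E" "a e \<notin> ?A" by (auto simp: param_cube_def PiE_iff)
      with a have "\<bar>a e\<bar> \<le> l" by (auto simp: param_cube_def PiE_iff dest!: bspec)
      with a \<open>e \<in> E\<close> show "a \<in> \<Union>F" by (intro cover) auto
    qed
    show "param_cube E - ?B \<in> sets (completion ?L)" using cube B by auto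
    have "param_cube E \<in> fmeasurable (completion ?L)"
      using cube ecube by (intro fmeasurableI) auto
    moreover have "\<Union>F \<in> sets (completion ?L)"
      using F(1,2) by (intro sets.finite_Union) auto
    moreover have "\<Union>F \<subseteq> param_cube E" using F(3) by (rule Union_least)
    ultimately show "\<Union>F \<in> fmeasurable (completion ?L)"
      using fmeasurableI2 by blast
  qed
  finally have "2 ^ card E * (1 - (1 - l) ^ card E) \<le> vol E (\<Union>F)"
    by (simp only: vol_def power_mult_distrib right_diff_distrib[of "2 ^ card E"] mult_1_right)
  then show ?thesis by (simp add: pos_le_divide_eq mult.commute)
qed

theorem theorem5p2:
  fixes p :: nat and E :: "(nat \<times> nat) set" and l :: real
  assumes "rooted_tree p E"
    and "0 < l" and "l < 1"
  shows "vol E (M_set p E l) / 2 ^ card E \<ge> 1 - (1 - l) ^ (p - 1) \<and>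
         vol E (N1_set p E l) / 2 ^ card E \<ge> 1 - (1 - l) ^ (p - 1) \<and>
         vol E (N2_set p E l) / 2 ^ card E \<ge> 1 - (1 - l) ^ (p - 1)"
proof -
  note T = assms(1)
  have E: "finite E" by (rule rooted_tree_edges(1)[OF T])
  \<comment> \<open>The index conditions of the three unions enter as one predicate
    \<open>R\<close>: it has to range over nodes and to admit every edge together with the parents
    of its tail.\<close>
  have bound: "1 - (1 - l) ^ (p - 1) \<le> vol E (\<Union>{P_set p E l i j S | i j S. R i j S}) / 2 ^ card E"
    if R: "\<And>i j S. R i j S \<Longrightarrow> i \<in> nodes p \<and> j \<in> nodes p \<and> S \<subseteq> nodes p - {i, j}"
      and edge: "\<And>i j. (i, j) \<in> E \<Longrightarrow> R i j {u. (u, i) \<in> E}" for R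
  proof -
    let ?F = "{P_set p E l i j S | i j S. R i j S}"
    \<comment> \<open>There are finitely many index triples, hence finitely many sets in the
      union.\<close>
    have "?F \<subseteq> (\<lambda>(i, j, S). P_set p E l i j S) ` (nodes p \<times> nodes p \<times> Pow (nodes p))"
      using R by force
    then have fin: "finite ?F" by (rule finite_subset) simp
    have "1 - (1 - l) ^ card E \<le> vol E (\<Union>?F) / 2 ^ card E"
    proof (rule vol_Union_lower_bound[OF E assms(2,3) fin])
      fix P assume "P \<in> ?F"
      then obtain i j S where P: "P = P_set p E l i j S" "R i j S" by auto
      then show "P \<in> sets (completion (\<Pi>\<^sub>M e\<in>E. lborel))"
        using R[OF P(2)] P_set_measurable[OF E, of S p i j l] by blast
      show "P \<subseteq> param_cube E" unfolding P(1) P_set_def by auto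
    next
      fix a e assume a: "a \<in> param_cube E" "e \<in> E" "\<bar>a e\<bar> \<le> l"
      obtain i j where e: "e = (i, j)" by (cases e)
      have "a \<in> P_set p E l i j {u. (u, i) \<in> E}"
        using small_coefficient_in_P_set[OF T _ a(1) assms(2)] a e by blast
      then show "a \<in> \<Union>?F" using edge a(2) e by blast
    qed
    \<comment> \<open>The base lies between 0 and 1, so at least \<open>p - 1\<close> edges can only
      make the power smaller.\<close>
    moreover have "(1 - l) ^ card E \<le> (1 - l) ^ (p - 1)"
      using rooted_tree_card_edges[OF T] assms(2,3) by (intro power_decreasing) auto
    ultimately show ?thesis by linarith
  qed
  \<comment> \<open>The side conditions of all three unions, verified together for the parents of
    \<open>i\<close> as conditioning set.\<close>
  have edge: "i \<in> nodes p \<and> j \<in> nodes p \<and> i \<noteq> j \<and> {u. (u, i) \<in> E} \<subseteq> nodes p - {i, j} \<and>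
      card {u. (u, i) \<in> E} \<le> max_degree p E \<and> \<not> d_separated E i j {u. (u, i) \<in> E}"
    if e: "(i, j) \<in> E" for i j
  proof -
    have ij: "i \<in> nodes p" "j \<in> nodes p" "i < j" using rooted_tree_edges(2)[OF T e] by auto
    \<comment> \<open>A parent of \<open>i\<close> is smaller than \<open>i\<close>, hence also
      smaller than \<open>j\<close>.\<close>
    moreover have "{u. (u, i) \<in> E} \<subseteq> nodes p - {i, j}"
      using rooted_tree_edges(2)[OF T] ij(3) by fastforce
    moreover have "\<not> d_separated E i j {u. (u, i) \<in> E}"
      using e ij(3) by (intro adjacent_not_d_separated) (auto simp: adjacent_def)
    ultimately show ?thesis using card_parents_le_max_degree[OF E ij(1)] by simp
  qed
  show ?thesis
    unfolding M_set_def N1_set_def N2_set_def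
    by (intro conjI bound) (use edge in \<open>auto dest: rooted_tree_edges(2)[OF T]\<close>)
qed

end
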